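(* Let $1<p<q<\infty$, $0\le\alpha<n$, and let $\mu$ be an upper Ahlfors $n$-dimensional measure on $\mathbb{R}^d$. Let $B$ be a submultiplicative Young function such that $B^{q_0/p_0}\in B_{q_0}$ for some $1<p_0\le n/\alpha$ and $1/q_0=1/p_0-\alpha/n$. Let $\phi$ and $\varphi$ be two Young functions such that, for some positive constants $C_1$ and $C_2$, $$C_1\,\varphi^{-1}(t)\,t^{\alpha/n}\le B^{-1}(t)\le C_2\,\phi^{-1}(t)\,t^{\alpha/n}.$$ Let $A$ and $C$ be two Young functions such that $A^{-1}C^{-1}\preceq B^{-1}$ and $C\in B_p$. Let $(u,v)$ be a pair of weights for which there is a constant $K$ such that for every cube $Q$ $$l(Q)^{\alpha-\frac np}\,u(3Q)^{\frac1q}\,\|v^{-\frac1p}\|_{A,Q}\le K .$$ Then there is a constant $K'$ such that for all $f\in L^p_\mu(v)$ $$\|\mathcal{M}_{\alpha,B}(f)\|_{L^q_\mu(u)}\le K'\,\|f\|_{L^p_\mu(v)}.$$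
   Context: Fix an integer $d\ge1$ and a real number $n$ with $0<n\le d$. All cubes are cubes in $\mathbb{R}^d$ with sides parallel to the coordinate axes; $l(Q)$ is the side length of $Q$, and $rQ$ ($r>0$) is the cube with the same centre as $Q$ and side length $r\,l(Q)$. An upper Ahlfors $n$-dimensional measure on $\mathbb{R}^d$ is a non-negative Borel measure $\mu$ with $\mu(Q)\le l(Q)^n$ for every cube $Q$. A Young function is a convex increasing function $B:[0,\infty)\to[0,\infty)$ with $B(0)=0$ and $B(t)\to\infty$ as $t\to\infty$. It is submultiplicative if $B(st)\le B(s)B(t)$ for all $s,t>0$. For $1<r<\infty$, a function $B$ satisfies the $B_r$ condition ($B\in B_r$) if there is $c>0$ with $\int_c^\infty \frac{B(t)}{t^r}\frac{dt}{t}<\infty$; the condition is defined only for finite $r$, and no separate meaning is given to it when $q_0=\infty$ (that is, when $p_0=n/\alpha$). When $\alpha=0$, $n/\alpha$ is read as $\infty$. For Young functions $A,B,C$, $A^{-1}C^{-1}\preceq B^{-1}$ means that there are $c,t_0>0$ with $A^{-1}(t)C^{-1}(t)\le c\,B^{-1}(t)$ for all $t\ge t_0$. The radial Luxemburg average is $$\|f\|_{B,Q}=\inf\Big\{\lambda>0:\ \frac1{l(Q)^n}\int_Q B\Big(\frac{|f(x)|}{\lambda}\Big)\,d\mu(x)\le 1\Big\},$$ and the radial fractional type maximal operator is $\mathcal{M}_{\alpha,B}(f)(x)=\sup_{Q\ni x} l(Q)^\alpha\|f\|_{B,Q}$, the supremum being over all cubes $Q$ containing $x$. Weights are non-negative $\mu$-locally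 integrable functions; $u(E)=\int_E u\,d\mu$; $\|f\|_{L^p_\mu(v)}=\left(\int_{\mathbb{R}^d}|f|^p v\,d\mu\right)^{1/p}$, and similarly for $L^q_\mu(u)$. *)

theory Defs
  imports "HOL-Analysis.Analysis"
begin

(* The closed axis-parallel cube with centre c and side length l; only used with l > 0.
   The dilate rQ of Q = cube c l is cube c (r * l). *)
definition cube :: "real ^ 'd \<Rightarrow> real \<Rightarrow> (real ^ 'd) set" where
  "cube c l = cbox (\<chi> i. c $ i - l / 2) (\<chi> i. c $ i + l / 2)"

definition upper_ahlfors :: "real \<Rightarrow> (real ^ 'd) measure \<Rightarrow> bool" where
  "upper_ahlfors n \<mu> \<longleftrightarrow>
     sets \<mu> = sets borel \<and> (\<forall>c l. l > 0 \<longrightarrow> emeasure \<mu> (cube c l) \<le> ennreal (l powr n))"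

(* Young functions are only meaningful on {0..}; their values at negative arguments are
   irrelevant.  Nonnegativity on {0..} follows from monotonicity and B 0 = 0. *)
definition young :: "(real \<Rightarrow> real) \<Rightarrow> bool" where
  "young B \<longleftrightarrow>
     convex_on {0..} B \<and> mono_on {0..} B \<and> B 0 = 0 \<and> filterlim B at_top at_top"

definition submultiplicative :: "(real \<Rightarrow> real) \<Rightarrow> bool" where
  "submultiplicative B \<longleftrightarrow> (\<forall>s>0. \<forall>t>0. B (s * t) \<le> B s * B t)"

(* The conjunct 1 < r is essential: an exponent q0 with 1 / q0 = 0, i.e. an infinite one, would
   be q0 = 0 under division by zero, and B_cond has no meaning there. *)
definition B_cond :: "real \<Rightarrow> (real \<Rightarrow> real) \<Rightarrow> bool" where
  "B_cond r B \<longleftrightarrow>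
     1 < r \<and> (\<exists>c>0. (\<integral>\<^sup>+ t\<in>{c..}. ennreal (B t / t powr r / t) \<partial>lborel) < \<infinity>)"

(* A Young function may vanish on an initial interval, so the generalised inverse is used.
   For t > 0 it is the unique s with B s = t. *)
definition young_inv :: "(real \<Rightarrow> real) \<Rightarrow> real \<Rightarrow> real" where
  "young_inv B t = Inf {s. 0 \<le> s \<and> t < B s}"

definition eventually_dominated :: "(real \<Rightarrow> real) \<Rightarrow> (real \<Rightarrow> real) \<Rightarrow> bool"
    (infix \<open>\<preceq>\<close> 50) where
  "F \<preceq> G \<longleftrightarrow> (\<exists>c>0. \<exists>t0>0. \<forall>t\<ge>t0. F t \<le> c * G t)"

(* Only used for exponents a > 0. *)
definition enn_powr :: "ennreal \<Rightarrow> real \<Rightarrow> ennreal" (infixr \<open>epowr\<close> 80) where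
  "x epowr a = (if x = \<infinity> then \<infinity> else ennreal (enn2real x powr a))"

(* Extension of a Young function by the value \<infinity> at \<infinity>. *)
definition young_ext :: "(real \<Rightarrow> real) \<Rightarrow> ennreal \<Rightarrow> ennreal" where
  "young_ext B x = (if x = \<infinity> then \<infinity> else ennreal (B (enn2real x)))"

(* The radial Luxemburg average over cube c l, for functions with values in [0,\<infinity>];
   infinite values occur for negative powers of weights.  The infimum of the empty set
   is \<infinity>. *)
definition lux_avg ::
    "(real ^ 'd) measure \<Rightarrow> real \<Rightarrow> (real \<Rightarrow> real) \<Rightarrow> real ^ 'd \<Rightarrow> real \<Rightarrow> (real ^ 'd \<Rightarrow> ennreal) \<Rightarrow> ennreal"
  where
  "lux_avg \<mu> n B c l g =
     Inf (ennreal ` {t. 0 < t \<and>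
       (\<integral>\<^sup>+ x\<in>cube c l. young_ext B (g x / ennreal t) \<partial>\<mu>) / ennreal (l powr n) \<le> 1})"

definition maximal_op ::
    "(real ^ 'd) measure \<Rightarrow> real \<Rightarrow> real \<Rightarrow> (real \<Rightarrow> real) \<Rightarrow> (real ^ 'd \<Rightarrow> real) \<Rightarrow> real ^ 'd \<Rightarrow> ennreal"
  where
  "maximal_op \<mu> n \<alpha> B f x =
     (SUP (c, l) \<in> {(c, l). l > 0 \<and> x \<in> cube c l}.
        ennreal (l powr \<alpha>) * lux_avg \<mu> n B c l (\<lambda>y. ennreal \<bar>f y\<bar>))"

definition weight :: "(real ^ 'd) measure \<Rightarrow> (real ^ 'd \<Rightarrow> real) \<Rightarrow> bool" where
  "weight \<mu> u \<longleftrightarrow>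
     u \<in> borel_measurable \<mu> \<and> (\<forall>x. 0 \<le> u x) \<and> (\<forall>S. compact S \<longrightarrow> set_integrable \<mu> S u)"

definition weighted_measure ::
    "(real ^ 'd) measure \<Rightarrow> (real ^ 'd \<Rightarrow> real) \<Rightarrow> (real ^ 'd) set \<Rightarrow> ennreal" where
  "weighted_measure \<mu> u E = (\<integral>\<^sup>+ x\<in>E. ennreal (u x) \<partial>\<mu>)"

definition Lp_norm ::
    "(real ^ 'd) measure \<Rightarrow> (real ^ 'd \<Rightarrow> real) \<Rightarrow> real \<Rightarrow> (real ^ 'd \<Rightarrow> ennreal) \<Rightarrow> ennreal" where
  "Lp_norm \<mu> v p g = (\<integral>\<^sup>+ x. (g x epowr p) * ennreal (v x) \<partial>\<mu>) epowr (1 / p)"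

definition Lp_space ::
    "(real ^ 'd) measure \<Rightarrow> (real ^ 'd \<Rightarrow> real) \<Rightarrow> real \<Rightarrow> (real ^ 'd \<Rightarrow> real) set" where
  "Lp_space \<mu> v p = {f \<in> borel_measurable \<mu>. Lp_norm \<mu> v p (\<lambda>x. ennreal \<bar>f x\<bar>) < \<infinity>}"

(* v^(-1/p) with the value \<infinity> where v vanishes; on reals, 0 powr (-1/p) would be 0. *)
definition weight_dual :: "(real ^ 'd \<Rightarrow> real) \<Rightarrow> real \<Rightarrow> real ^ 'd \<Rightarrow> ennreal" where
  "weight_dual v p x = inverse (ennreal (v x powr (1 / p)))"

end

theory Submission
  imports Defs
begin

text \<open>
  The idea is that, because \<open>p < q\<close>, the supremum in the maximal operator can be replaced by a sum
  over \<^emph>\<open>all\<close> dyadic cubes.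

  Every cube \<open>Q\<close> is covered by at most \<open>2 ^ d\<close> dyadic cubes \<open>P\<close> of comparable side whose triples
  contain \<open>Q\<close>, and the average of \<open>f\<close> over one of them controls the average over \<open>Q\<close>
  (\<open>lux_avg_le_dyadic\<close>). Hence the \<open>q\<close>-th power of the maximal function at \<open>x\<close> is at most a constant
  times the sum, over all dyadic \<open>P\<close> whose triple contains \<open>x\<close>, of the \<open>q\<close>-th powers of
  \<open>l(P) powr \<alpha>\<close> times the \<open>B\<close>-average of \<open>f\<close>. Integrating against \<open>u\<close> turns the indicator of the triple
  into \<open>u(3P)\<close>.

  Put \<open>g = \<bar>f\<bar> v powr (1/p)\<close>. The relation between \<open>A\<close>, \<open>B\<close> and \<open>C\<close> gives a Hoelder inequality which
  bounds the \<open>B\<close>-average of \<open>f\<close> by the \<open>C\<close>-average of \<open>g\<close> times the \<open>A\<close>-average of \<open>v powr (-1/p)\<close>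
  (\<open>lux_avg_holder\<close>). The bump condition on \<open>(u, v)\<close> then absorbs \<open>u(3P)\<close> and the \<open>A\<close>-average, and
  each summand is at most a constant times \<open>l(P) powr (n q / p)\<close> times the \<open>q\<close>-th power of the
  \<open>C\<close>-average of \<open>g\<close> over \<open>P\<close>.

  What remains is an inequality of Carleson type: the sum of these quantities over all dyadic
  cubes is bounded by the \<open>(q/p)\<close>-th power of the integral of \<open>g powr p\<close> (\<open>dyadic_carleson\<close>). It holds
  because \<open>g\<close> contributes to the average over \<open>P\<close>, at a given height, only if \<open>l(P)\<close> is small; the gap
  between \<open>q\<close> and \<open>p\<close> makes the sum over the small generations geometric, and the \<open>B\<^sub>p\<close> condition on \<open>C\<close>
  sums the heights (\<open>B_cond_dyadic_sum\<close>). The growth condition on \<open>\<mu>\<close> is what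
  allows the normalization by \<open>l(P) powr n\<close> instead of \<open>\<mu>(P)\<close>: it keeps the averages of bounded
  functions bounded.

  Sums are written as integrals over counting measures, so that infinite values and
  interchanges of summation need no special care.
\<close>

section \<open>Extended powers\<close>

lemma epowr_ennreal: "0 \<le> x \<Longrightarrow> ennreal x epowr a = ennreal (x powr a)"
  by (simp add: enn_powr_def)

lemma epowr_top [simp]: "top epowr a = top"
  by (simp add: enn_powr_def)

lemma epowr_zero [simp]: "0 epowr a = 0"
  by (simp add: enn_powr_def)

lemma epowr_one [simp]: "x epowr 1 = x"
  by (cases x) (auto simp: epowr_ennreal)

lemma epowr_mono:
  assumes "0 \<le> a" and "x \<le> y"
  shows "x epowr a \<le> y epowr a"
  using assms by (cases x; cases y) (auto simp: epowr_ennreal powr_mono2 top_unique)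

lemma epowr_epowr: "(x epowr a) epowr b = x epowr (a * b)"
  by (cases x) (auto simp: epowr_ennreal powr_powr)

text \<open>The case of \<open>0\<close> times \<open>\<infinity>\<close> is consistent because \<open>0 powr a = 0\<close> for every \<open>a\<close>, even for
  \<open>a = 0\<close>; the same convention makes the sum rule below hold at \<open>0\<close>.\<close>

lemma epowr_mult: "(x * y) epowr a = x epowr a * y epowr a"
proof (cases "x = top \<or> y = top")
  case True
  then show ?thesis
    by (cases x; cases y)
      (auto simp: epowr_ennreal ennreal_mult_top ennreal_top_mult ennreal_mult_eq_top_iff)
next
  case False
  then show ?thesis
    by (cases x; cases y) (auto simp: epowr_ennreal powr_mult simp flip: ennreal_mult)
qed

lemma epowr_add: "x epowr (a + b) = x epowr a * x epowr b"
  by (cases x) (auto simp: epowr_ennreal powr_add ennreal_mult)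

lemma borel_measurable_epowr [measurable (raw)]:
  assumes [measurable]: "f \<in> borel_measurable M"
  shows "(\<lambda>x. f x epowr a) \<in> borel_measurable M"
  unfolding enn_powr_def by measurable

section \<open>Young functions\<close>

lemma young_mono: "young B \<Longrightarrow> 0 \<le> s \<Longrightarrow> s \<le> t \<Longrightarrow> B s \<le> B t"
  by (auto simp: young_def mono_on_def)

lemma young_nonneg: "young B \<Longrightarrow> 0 \<le> s \<Longrightarrow> 0 \<le> B s"
  using young_mono[of B 0 s] by (simp add: young_def)

lemma young_scale:
  assumes "young B" "0 \<le> s" "0 \<le> a" "a \<le> 1"
  shows "B (a * s) \<le> a * B s"
proof -
  have "convex_on {0..} B" "B 0 = 0" using assms(1) by (auto simp: young_def)
  then have "B ((1 - a) *\<^sub>R 0 + a *\<^sub>R s) \<le> (1 - a) * B 0 + a * B s"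
    using assms by (intro convex_onD) auto
  then show ?thesis using \<open>B 0 = 0\<close> by simp
qed

lemma young_unbounded:
  assumes "young B"
  shows "\<exists>s\<ge>0. t < B s"
proof -
  have "eventually (\<lambda>s. t < B s) at_top" "eventually (\<lambda>s::real. 0 \<le> s) at_top"
    using assms by (auto simp: young_def filterlim_at_top_dense eventually_ge_at_top)
  then have "eventually (\<lambda>s. t < B s \<and> 0 \<le> s) at_top" by (rule eventually_conj)
  from eventually_happens'[OF _ this] show ?thesis by auto
qed

text \<open>Nothing is known about a Young function on the negative half-line; cutting the argument off at
  \<open>0\<close> turns monotonicity on the half-line into monotonicity everywhere, hence into measurability.\<close>

lemma borel_measurable_young:
  assumes "young B"
  shows "(\<lambda>s. B (max 0 s)) \<in> borel_measurable borel"
  by (rule borel_measurable_mono) (auto intro!: monoI young_mono[OF assms])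

lemma borel_measurable_young_ext [measurable (raw)]:
  assumes "young B" and [measurable]: "f \<in> borel_measurable M"
  shows "(\<lambda>x. young_ext B (f x)) \<in> borel_measurable M"
proof -
  note [measurable] = borel_measurable_young[OF assms(1)]
  have "(\<lambda>x. young_ext B (f x)) =
      (\<lambda>x. if f x = \<infinity> then \<infinity> else ennreal ((\<lambda>s. B (max 0 s)) (enn2real (f x))))"
    by (auto simp: young_ext_def)
  also have "\<dots> \<in> borel_measurable M" by measurable
  finally show ?thesis .
qed

lemma young_ext_mono:
  assumes "young B" "x \<le> y"
  shows "young_ext B x \<le> young_ext B y"
proof (cases "y = \<infinity>")
  case False
  then have "x \<noteq> \<infinity>" "enn2real x \<le> enn2real y"
    using assms(2) by (auto simp: top_unique less_top intro: enn2real_mono)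
  then show ?thesis
    using False young_mono[OF assms(1), of "enn2real x" "enn2real y"]
    by (simp add: young_ext_def ennreal_leI)
qed (simp add: young_ext_def)

text \<open>Convexity together with the value \<open>0\<close> at \<open>0\<close>. This is what converts a modular bounded by a
  constant \<open>R\<close> instead of \<open>1\<close> into a Luxemburg norm bounded by \<open>R\<close>.\<close>

lemma young_ext_scale:
  assumes "young B" "1 \<le> R"
  shows "ennreal R * young_ext B (x / ennreal R) \<le> young_ext B x"
proof (cases x)
  case (real r)
  have "R * B (r / R) \<le> B r"
    using young_scale[of B r "1 / R"] assms real by (simp add: field_simps)
  then show ?thesis
    using assms real
    by (auto simp: young_ext_def divide_ennreal simp flip: ennreal_mult' intro!: ennreal_leI)
qed (simp add: young_ext_def)

lemma young_inv_le:
  assumes "young B" "0 \<le> s" "t < B s"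
  shows "young_inv B t \<le> s"
  unfolding young_inv_def using assms by (intro cInf_lower bdd_belowI[of _ 0]) auto

lemma le_young_inv:
  assumes "young B" "0 \<le> s" "B s \<le> t"
  shows "s \<le> young_inv B t"
  unfolding young_inv_def
proof (rule cInf_greatest)
  show "{s. 0 \<le> s \<and> t < B s} \<noteq> {}" using young_unbounded[OF assms(1)] by auto
  fix r assume "r \<in> {s. 0 \<le> s \<and> t < B s}"
  then show "s \<le> r" using young_mono[OF assms(1), of r s] assms by (cases "s \<le> r") auto
qed

text \<open>The relation between the inverses is Young's inequality for the product. It is only known
  for large arguments, and a constant summand makes up for the small ones.\<close>

lemma young_inequality:
  assumes "young A" "young B" "young C"
    and dom: "(\<lambda>t. young_inv A t * young_inv C t) \<preceq> young_inv B"
  obtains c t0 where "0 < c" "0 < t0"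
    "\<And>x y. 0 \<le> x \<Longrightarrow> 0 \<le> y \<Longrightarrow> B (x * y / c) \<le> A x + C y + t0"
proof -
  from dom obtain c t0 where c: "0 < c" "0 < t0"
    and le: "\<And>t. t0 \<le> t \<Longrightarrow> young_inv A t * young_inv C t \<le> c * young_inv B t"
    unfolding eventually_dominated_def by blast
  \<comment> \<open>The factor \<open>2\<close> replaces the continuity of \<open>B\<close>: a point strictly below
    \<open>young_inv B t\<close> has a value at most \<open>t\<close>, and half of a positive point is strictly below it.\<close>
  have "B (x * y / (2 * c)) \<le> A x + C y + t0" if "0 \<le> x" "0 \<le> y" for x y
  proof (rule ccontr)
    define t where "t = A x + C y + t0"
    assume "\<not> ?thesis"
    then have "t < B (x * y / (2 * c))" by (simp add: t_def)
    moreover have "0 \<le> A x" "0 \<le> C y" using that assms young_nonneg by auto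
    ultimately have inv: "young_inv B t \<le> x * y / (2 * c)" and "0 < B (x * y / (2 * c))"
      using that c assms by (auto intro: young_inv_le simp: t_def)
    then have "x * y \<noteq> 0" using assms(2) by (auto simp: young_def)
    then have pos: "0 < x * y" using that by (simp add: less_le)
    have "x \<le> young_inv A t" "y \<le> young_inv C t"
      using that c assms \<open>0 \<le> A x\<close> \<open>0 \<le> C y\<close> by (auto intro!: le_young_inv simp: t_def)
    then have "x * y \<le> young_inv A t * young_inv C t" using that by (intro mult_mono) auto
    also have "\<dots> \<le> c * young_inv B t"
      using \<open>0 \<le> A x\<close> \<open>0 \<le> C y\<close> by (intro le) (simp add: t_def)
    also have "\<dots> \<le> x * y / 2" using mult_left_mono[OF inv, of c] c by simp
    finally show False using pos by simp
  qed
  then show ?thesis using c that[of "2 * c" t0] by auto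
qed

section \<open>Luxemburg averages\<close>

text \<open>The strict inequality in the hypothesis is there because the infimum need not be attained; above it
  the modular is monotone.\<close>

lemma lux_avg_lessD:
  assumes "young B" "0 < l" "lux_avg \<mu> n B c l g < ennreal t"
  shows "(\<integral>\<^sup>+ x\<in>cube c l. young_ext B (g x / ennreal t) \<partial>\<mu>) \<le> ennreal (l powr n)"
proof -
  have l: "0 < ennreal (l powr n)" "ennreal (l powr n) < top" using assms by auto
  obtain s where s: "0 < s" "ennreal s < ennreal t"
    and le: "(\<integral>\<^sup>+ x\<in>cube c l. young_ext B (g x / ennreal s) \<partial>\<mu>) / ennreal (l powr n) \<le> 1"
    using assms(3) unfolding lux_avg_def Inf_less_iff by auto
  have "(\<integral>\<^sup>+ x\<in>cube c l. young_ext B (g x / ennreal t) \<partial>\<mu>)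
      \<le> (\<integral>\<^sup>+ x\<in>cube c l. young_ext B (g x / ennreal s) \<partial>\<mu>)"
  proof (intro nn_integral_mono mult_right_mono young_ext_mono assms(1))
    have "0 < t" using s order.strict_trans[of 0 s t] by (auto simp: ennreal_less_iff)
    then have "inverse (ennreal t) \<le> inverse (ennreal s)"
      using s by (auto simp: inverse_ennreal ennreal_less_iff intro!: ennreal_leI)
    then show "g x / ennreal t \<le> g x / ennreal s" for x
      by (simp add: divide_ennreal_def mult_left_mono)
  qed simp
  also have "\<dots> = (\<integral>\<^sup>+ x\<in>cube c l. young_ext B (g x / ennreal s) \<partial>\<mu>) / ennreal (l powr n)
      * ennreal (l powr n)"
    using l by (simp add: ennreal_divide_times ennreal_divide_self)
  also have "\<dots> \<le> 1 * ennreal (l powr n)" by (rule mult_right_mono[OF le]) simp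
  finally show ?thesis by simp
qed

lemma lux_avg_leI:
  assumes "young B" "0 < l" "0 < t" "1 \<le> R" and "sets \<mu> = sets borel"
    and g [measurable]: "g \<in> borel_measurable \<mu>"
    and le: "(\<integral>\<^sup>+ x\<in>cube c l. young_ext B (g x / ennreal t) \<partial>\<mu>) \<le> ennreal (R * l powr n)"
  shows "lux_avg \<mu> n B c l g \<le> ennreal (R * t)"
proof -
  note [measurable] = \<open>young B\<close>
  have [measurable]: "cube c l \<in> sets \<mu>" using assms by (simp add: cube_def)
  have "ennreal R * (\<integral>\<^sup>+ x\<in>cube c l. young_ext B (g x / ennreal (R * t)) \<partial>\<mu>)
      = (\<integral>\<^sup>+ x\<in>cube c l. ennreal R * young_ext B (g x / ennreal (R * t)) \<partial>\<mu>)"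
    by (subst nn_integral_cmult[symmetric]) (auto simp: mult.assoc)
  also have "\<dots> \<le> (\<integral>\<^sup>+ x\<in>cube c l. young_ext B (g x / ennreal t) \<partial>\<mu>)"
  proof (intro nn_integral_mono mult_right_mono)
    fix x
    have "g x / ennreal (R * t) = (g x / ennreal t) / ennreal R"
      using assms by (simp add: divide_ennreal_def ennreal_mult ennreal_inverse_mult mult_ac)
    then show "ennreal R * young_ext B (g x / ennreal (R * t)) \<le> young_ext B (g x / ennreal t)"
      using young_ext_scale[OF assms(1,4)] by simp
  qed simp
  also note le
  finally have "ennreal R * (\<integral>\<^sup>+ x\<in>cube c l. young_ext B (g x / ennreal (R * t)) \<partial>\<mu>)
      \<le> ennreal R * ennreal (l powr n)"
    using assms by (simp add: ennreal_mult)
  then have "(\<integral>\<^sup>+ x\<in>cube c l. young_ext B (g x / ennreal (R * t)) \<partial>\<mu>) \<le> ennreal (l powr n)"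
    using assms by (subst (asm) ennreal_mult_le_mult_iff) auto
  then have "(\<integral>\<^sup>+ x\<in>cube c l. young_ext B (g x / ennreal (R * t)) \<partial>\<mu>) / ennreal (l powr n) \<le> 1"
    using assms by (intro divide_le_posI_ennreal) auto
  then show ?thesis
    unfolding lux_avg_def using assms by (intro Inf_lower imageI) auto
qed



section \<open>Sums over countable index sets\<close>

lemma borel_measurable_nn_integral_count_space:
  fixes f :: "'i :: countable \<Rightarrow> 'a \<Rightarrow> ennreal"
  assumes [measurable]: "\<And>i. f i \<in> borel_measurable M"
  shows "(\<lambda>x. \<integral>\<^sup>+ i. f i x \<partial>count_space UNIV) \<in> borel_measurable M"
proof (rule sigma_finite_measure.borel_measurable_nn_integral[OF sigma_finite_measure_count_space])
  show "(\<lambda>(x, i). f i x) \<in> borel_measurable (M \<Otimes>\<^sub>M count_space UNIV)"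
    unfolding split_beta by (rule measurable_compose_countable[where g = snd]) measurable
qed

lemma count_indicator_le:
  assumes "finite S" "card S \<le> N" "\<And>i. P i \<Longrightarrow> i \<in> S"
  shows "(\<integral>\<^sup>+ i. indicator {i. P i} i \<partial>count_space UNIV) \<le> ennreal (real N)"
proof -
  have sub: "{i. P i} \<subseteq> S" using assms(3) by auto
  have "(\<integral>\<^sup>+ i. indicator {i. P i} i \<partial>count_space UNIV) = emeasure (count_space UNIV) {i. P i}"
    by (simp del: emeasure_count_space)
  also have "\<dots> \<le> emeasure (count_space UNIV) S" by (rule emeasure_mono[OF sub]) simp
  also have "\<dots> = ennreal (real (card S))"
    using assms(1) by (simp add: ennreal_of_nat_eq_real_of_nat)
  finally show ?thesis using assms(2) by (meson ennreal_leI of_nat_mono order_trans)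
qed

text \<open>Each term is at most the whole sum \<open>S\<close>, so \<open>x\<^sup>r = x x\<^sup>r\<^sup>-\<^sup>1 \<le> x S\<^sup>r\<^sup>-\<^sup>1\<close>. This is the inclusion
  of \<open>l\<^sup>1\<close> in \<open>l\<^sup>r\<close>.\<close>

lemma sum_epowr_le:
  fixes x :: "'i \<Rightarrow> ennreal"
  assumes "1 \<le> r"
  shows "(\<integral>\<^sup>+ i. x i epowr r \<partial>count_space UNIV) \<le> (\<integral>\<^sup>+ i. x i \<partial>count_space UNIV) epowr r"
proof -
  define S where "S = (\<integral>\<^sup>+ i. x i \<partial>count_space UNIV)"
  have split: "y epowr r = y * y epowr (r - 1)" for y
    using epowr_add[of y 1 "r - 1"] by simp
  have "(\<integral>\<^sup>+ i. x i epowr r \<partial>count_space UNIV)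
      \<le> (\<integral>\<^sup>+ i. x i * S epowr (r - 1) \<partial>count_space UNIV)"
  proof (intro nn_integral_mono)
    fix i
    have "x i \<le> S" unfolding S_def by (rule nn_integral_ge_point) simp
    then show "x i epowr r \<le> x i * S epowr (r - 1)"
      unfolding split[of "x i"] using assms by (intro mult_left_mono epowr_mono) auto
  qed
  also have "\<dots> = S * S epowr (r - 1)" by (simp add: nn_integral_multc S_def)
  finally show ?thesis by (simp add: split S_def)
qed

text \<open>A geometric series with positive exponent \<open>b\<close>, cut off at the scale where
  \<open>2 powr (n * k)\<close> reaches \<open>X\<close>, is comparable with its largest term.\<close>

lemma dyadic_geometric_sum:
  fixes b n :: real
  assumes "0 < b" "0 < n"
  obtains c where "0 < c"
    "\<And>X :: ennreal. (\<integral>\<^sup>+ k. ennreal (2 powr (b * real_of_int k))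
        * indicator {k. ennreal (2 powr (n * real_of_int k)) < X} k \<partial>count_space UNIV)
      \<le> ennreal c * X epowr (b / n)"
proof -
  define c where "c = 1 / (1 - 2 powr (- b))"
  have th: "0 < (2::real) powr (- b)" "(2::real) powr (- b) < 1"
    using assms powr_less_mono[of "- b" 0 2] by auto
  then have c: "0 < c" by (simp add: c_def)
  have "(\<integral>\<^sup>+ k. ennreal (2 powr (b * real_of_int k))
        * indicator {k. ennreal (2 powr (n * real_of_int k)) < X} k \<partial>count_space UNIV)
      \<le> ennreal c * X epowr (b / n)" (is "?L \<le> _") for X
  proof (cases X)
    case (real r)
    show ?thesis
    proof (cases "r = 0")
      case True
      then show ?thesis using real by simp
    next
      case False
      then have r: "0 < r" using real by simp
      \<comment> \<open>The largest admissible index; the sum is turned around to start from it.\<close>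
      define k0 where "k0 = \<lfloor>log 2 r / n\<rfloor>"
      have "k \<le> k0" if "ennreal (2 powr (n * real_of_int k)) < X" for k
      proof -
        have "2 powr (n * real_of_int k) < r" using that real by (simp add: ennreal_less_iff)
        then have "n * real_of_int k < log 2 r" using r by (simp add: less_log_iff)
        then have "real_of_int k \<le> log 2 r / n" using assms by (simp add: field_simps)
        then show ?thesis by (simp add: k0_def le_floor_iff)
      qed
      then have "?L \<le> (\<integral>\<^sup>+ k. ennreal (2 powr (b * real_of_int k))
          * indicator {..k0} k \<partial>count_space UNIV)"
        by (intro nn_integral_mono mult_left_mono) (auto simp: indicator_def)
      also have "\<dots> = (\<integral>\<^sup>+ k. ennreal (2 powr (b * real_of_int k)) \<partial>count_space {..k0})"
        by (simp add: nn_integral_count_space_indicator)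
      also have "\<dots> = (\<integral>\<^sup>+ i. ennreal (2 powr (b * real_of_int (k0 - int i))) \<partial>count_space UNIV)"
        by (rule nn_integral_bij_count_space[symmetric])
          (auto intro!: bij_betwI[where g = "\<lambda>k. nat (k0 - k)"])
      also have "\<dots> = (\<integral>\<^sup>+ i. ennreal (2 powr (b * real_of_int k0)) * ennreal ((2 powr (- b)) ^ i)
          \<partial>count_space UNIV)"
      proof (intro nn_integral_cong)
        fix i :: nat
        have "(2::real) powr (b * real_of_int (k0 - int i)) = 2 powr (b * real_of_int k0) * (2 powr (- b)) ^ i"
          by (simp add: algebra_simps powr_realpow[symmetric] powr_powr flip: powr_add)
        then show "ennreal (2 powr (b * real_of_int (k0 - int i)))
            = ennreal (2 powr (b * real_of_int k0)) * ennreal ((2 powr (- b)) ^ i)"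
          by (simp flip: ennreal_mult)
      qed
      also have "\<dots> = ennreal (2 powr (b * real_of_int k0)) * (\<Sum>i. ennreal ((2 powr (- b)) ^ i))"
        by (simp add: nn_integral_cmult nn_integral_count_space_nat)
      also have "(\<Sum>i. ennreal ((2 powr (- b)) ^ i)) = ennreal c"
        unfolding c_def using th
        by (subst suminf_ennreal_eq[OF _ geometric_sums]) auto
      also have "ennreal (2 powr (b * real_of_int k0)) * ennreal c \<le> ennreal (r powr (b / n)) * ennreal c"
      proof (intro mult_right_mono ennreal_leI)
        have "real_of_int k0 \<le> log 2 r / n" by (simp add: k0_def)
        then have "b * real_of_int k0 \<le> log 2 r * (b / n)"
          using mult_left_mono[of "real_of_int k0" "log 2 r / n" b] assms by (simp add: mult.commute)
        then have "2 powr (b * real_of_int k0) \<le> 2 powr (log 2 r * (b / n))" by simp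
        also have "\<dots> = r powr (b / n)" unfolding powr_powr[symmetric] using r by simp
        finally show "2 powr (b * real_of_int k0) \<le> r powr (b / n)" .
      qed simp
      finally show ?thesis using real by (simp add: epowr_ennreal mult.commute)
    qed
  qed (use c in simp)
  then show ?thesis using c that by blast
qed

text \<open>A discrete layer cake formula: for \<open>0 < x < \<infinity>\<close> the term with the largest \<open>j\<close> such
  that \<open>2 powr j < x\<close> already controls \<open>x epowr q\<close>, and for \<open>x = \<infinity>\<close> the terms are unbounded.\<close>

lemma epowr_le_dyadic_sum:
  assumes "0 < q"
  shows "x epowr q \<le> ennreal (2 powr q) * (\<integral>\<^sup>+ j. ennreal (2 powr (q * real_of_int j))
      * indicator {j. ennreal (2 powr real_of_int j) < x} j \<partial>count_space UNIV)"
    (is "_ \<le> _ * ?S")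
proof -
  have single: "ennreal (2 powr (q * real_of_int j)) \<le> ?S" if "ennreal (2 powr real_of_int j) < x" for j
    using nn_integral_ge_point[of j UNIV "\<lambda>j. ennreal (2 powr (q * real_of_int j))
      * indicator {j. ennreal (2 powr real_of_int j) < x} j"] that by simp
  show ?thesis
  proof (cases x)
    case (real r)
    show ?thesis
    proof (cases "r = 0")
      case False
      then have r: "0 < r" using real by simp
      \<comment> \<open>The index with \<open>2 powr j < r \<le> 2 powr (j + 1)\<close>.\<close>
      define j where "j = \<lceil>log 2 r\<rceil> - 1"
      have "real_of_int j < log 2 r" "log 2 r \<le> real_of_int j + 1" unfolding j_def by linarith+
      then have j: "2 powr real_of_int j < r" "r \<le> 2 powr (real_of_int j + 1)"
        using r by (auto simp: less_log_iff log_le_iff)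
      have "r powr q \<le> (2 powr (real_of_int j + 1)) powr q"
        using j r assms by (intro powr_mono2) auto
      also have "\<dots> = 2 powr q * 2 powr (q * real_of_int j)"
        by (simp add: powr_powr algebra_simps flip: powr_add)
      finally have "x epowr q \<le> ennreal (2 powr q) * ennreal (2 powr (q * real_of_int j))"
        using real by (simp add: epowr_ennreal ennreal_leI flip: ennreal_mult)
      also have "\<dots> \<le> ennreal (2 powr q) * ?S"
        using j real by (intro mult_left_mono single) (auto simp: ennreal_less_iff)
      finally show ?thesis .
    qed (use real in simp)
  next
    case top
    have "?S = top"
    proof (rule ccontr)
      assume "?S \<noteq> top"
      then obtain s where s: "?S = ennreal s" "0 \<le> s" by (cases ?S) auto
      define j where "j = \<lceil>log 2 (s + 1) / q\<rceil>"
      have "log 2 (s + 1) / q \<le> real_of_int j" by (simp add: j_def)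
      then have "log 2 (s + 1) \<le> q * real_of_int j" using assms by (simp add: field_simps)
      then have "s + 1 \<le> 2 powr (q * real_of_int j)" using s by (simp add: log_le_iff)
      moreover have "ennreal (2 powr (q * real_of_int j)) \<le> ennreal s"
        using single[of j] top s by simp
      ultimately show False using s by simp
    qed
    then show ?thesis by (simp add: ennreal_mult_top)
  qed
qed

section \<open>The condition \<open>B\<^sub>p\<close> in dyadic form\<close>

text \<open>The lower limit of the integral is immaterial as long as it is positive, because a Young function is
  bounded on bounded intervals.\<close>

lemma B_cond_tail_finite:
  assumes "young C" "B_cond p C" "0 < s"
  shows "(\<integral>\<^sup>+ t\<in>{s..}. ennreal (C t / t powr p / t) \<partial>lborel) < \<infinity>"
proof -
  have p: "1 < p" using assms(2) by (simp add: B_cond_def)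
  obtain c where c: "0 < c" "(\<integral>\<^sup>+ t\<in>{c..}. ennreal (C t / t powr p / t) \<partial>lborel) < \<infinity>"
    using assms(2) by (auto simp: B_cond_def)
  define h where "h t = ennreal (C (max 0 t) / t powr p / t)" for t
  note [measurable] = borel_measurable_young[OF assms(1)]
  have [measurable]: "h \<in> borel_measurable borel" unfolding h_def by measurable
  have tail: "(\<integral>\<^sup>+ t\<in>{a..}. ennreal (C t / t powr p / t) \<partial>lborel) = (\<integral>\<^sup>+ t. h t * indicator {a..} t \<partial>lborel)"
    if "0 < a" for a
    using that by (intro nn_integral_cong) (auto simp: h_def indicator_def max_def)
  have "h t * indicator {s..} t
      \<le> ennreal (C c / s powr p / s) * indicator {s..c} t + h t * indicator {c..} t" for t
  proof (cases "s \<le> t \<and> t \<le> c")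
    case True
    have "C t / t powr p / t \<le> C c / s powr p / s"
      using True assms p young_mono[OF assms(1), of t c] young_nonneg[OF assms(1)]
      by (intro frac_le powr_mono2 divide_nonneg_nonneg) auto
    then show ?thesis using True assms(3) by (auto simp: h_def indicator_def max_def intro!: add_increasing2 ennreal_leI)
  qed (auto simp: indicator_def)
  then have "(\<integral>\<^sup>+ t. h t * indicator {s..} t \<partial>lborel)
      \<le> (\<integral>\<^sup>+ t. ennreal (C c / s powr p / s) * indicator {s..c} t + h t * indicator {c..} t \<partial>lborel)"
    by (intro nn_integral_mono) auto
  also have "\<dots> = (\<integral>\<^sup>+ t. ennreal (C c / s powr p / s) * indicator {s..c} t \<partial>lborel)
      + (\<integral>\<^sup>+ t. h t * indicator {c..} t \<partial>lborel)"
    by (rule nn_integral_add) auto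
  also have "\<dots> < \<infinity>"
    using c tail[OF c(1)]
    by (auto simp: nn_integral_cmult_indicator ennreal_mult_less_top emeasure_lborel_Icc_eq)
  finally show ?thesis using tail[OF assms(3)] by simp
qed

text \<open>With \<open>y\<^sub>j = g / 2 powr j\<close>, monotonicity of \<open>C\<close> bounds \<open>C (y\<^sub>j)\<close> by a
  constant times \<open>y\<^sub>j powr p\<close> times the integral of \<open>C t / t powr (p + 1)\<close> over the interval from \<open>y\<^sub>j\<close> to \<open>2 y\<^sub>j\<close>.
  The factor \<open>2 powr (p * j)\<close> turns \<open>y\<^sub>j powr p\<close> into \<open>g powr p\<close>, and since these intervals are
  disjoint and lie to the right of \<open>s\<close>, the integrals add up to at most the tail integral.\<close>

lemma B_cond_dyadic_sum:
  assumes C: "young C" and Bp: "B_cond p C" and s: "0 < s"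
  obtains c where "0 < c"
    "\<And>g. 0 \<le> g \<Longrightarrow> (\<integral>\<^sup>+ j. ennreal (2 powr (p * real_of_int j)) *
        ennreal (if s * 2 powr real_of_int j < g then C (g / 2 powr real_of_int j) else 0) \<partial>count_space UNIV)
      \<le> ennreal (c * g powr p)"
proof -
  define h where "h t = ennreal (C (max 0 t) / t powr p / t) * indicator {s..} t" for t
  note [measurable] = borel_measurable_young[OF C]
  have [measurable]: "h \<in> borel_measurable borel" unfolding h_def by measurable
  have p: "1 < p" using Bp by (simp add: B_cond_def)
  have "(\<integral>\<^sup>+ t. h t \<partial>lborel) = (\<integral>\<^sup>+ t\<in>{s..}. ennreal (C t / t powr p / t) \<partial>lborel)"
    using s by (intro nn_integral_cong) (auto simp: h_def indicator_def max_def)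
  then have "(\<integral>\<^sup>+ t. h t \<partial>lborel) < \<infinity>" using B_cond_tail_finite[OF C Bp s] by simp
  then obtain J where J: "0 \<le> J" "(\<integral>\<^sup>+ t. h t \<partial>lborel) = ennreal J"
    by (cases "\<integral>\<^sup>+ t. h t \<partial>lborel") auto
  \<comment> \<open>\<open>J + 1\<close> instead of \<open>J\<close> keeps the constant positive.\<close>
  define c where "c = 2 * 2 powr p * (J + 1)"
  have "(\<integral>\<^sup>+ j. ennreal (2 powr (p * real_of_int j)) *
        ennreal (if s * 2 powr real_of_int j < g then C (g / 2 powr real_of_int j) else 0) \<partial>count_space UNIV)
      \<le> ennreal (c * g powr p)" (is "?L \<le> _") if g: "0 \<le> g" for g
  proof -
    define y where "y j = g / 2 powr real_of_int j" for j
    define E where "E = ennreal (2 * 2 powr p * g powr p)"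
    have "ennreal (2 powr (p * real_of_int j)) *
        ennreal (if s * 2 powr real_of_int j < g then C (g / 2 powr real_of_int j) else 0)
      \<le> E * (\<integral>\<^sup>+ t. h t * indicator {y j <.. 2 * y j} t \<partial>lborel)" for j
    proof (cases "s * 2 powr real_of_int j < g")
      case True
      then have y: "s < y j" by (simp add: y_def field_simps)
      then have y0: "0 < y j" using s by simp
      define a where "a = C (y j) / (2 * y j) powr p / (2 * y j)"
      have Cy: "0 \<le> C (y j)" using C y0 by (simp add: young_nonneg)
      then have a: "0 \<le> a" using y0 by (simp add: a_def)
      have "ennreal (a * y j) = (\<integral>\<^sup>+ t. ennreal a * indicator {y j <.. 2 * y j} t \<partial>lborel)"
        using y0 a by (simp add: nn_integral_cmult_indicator ennreal_mult)
      also have "\<dots> \<le> (\<integral>\<^sup>+ t. h t * indicator {y j <.. 2 * y j} t \<partial>lborel)"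
      proof (intro nn_integral_mono)
        fix t
        show "ennreal a * indicator {y j <.. 2 * y j} t \<le> h t * indicator {y j <.. 2 * y j} t"
        proof (cases "y j < t \<and> t \<le> 2 * y j")
          case True
          then have "a \<le> C t / t powr p / t"
            unfolding a_def using y0 p young_mono[OF C, of "y j" t] Cy
            by (intro frac_le powr_mono2 divide_nonneg_nonneg) auto
          then show ?thesis using True y0 y by (auto simp: h_def indicator_def max_def intro!: ennreal_leI)
        qed (auto simp: indicator_def)
      qed
      finally have le: "ennreal (a * y j) \<le> (\<integral>\<^sup>+ t. h t * indicator {y j <.. 2 * y j} t \<partial>lborel)" .
      have gy: "g = 2 powr real_of_int j * y j" by (simp add: y_def)
      have "2 * 2 powr p * g powr p * (a * y j)
          = (2 powr real_of_int j) powr p * C (y j)"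
        unfolding a_def using y0 by (subst gy) (simp add: powr_mult)
      then have "2 powr (p * real_of_int j) * C (y j) = 2 * 2 powr p * g powr p * (a * y j)"
        by (simp add: powr_powr mult.commute)
      then have "ennreal (2 powr (p * real_of_int j)) * ennreal (C (y j)) = E * ennreal (a * y j)"
        unfolding E_def using a y0 Cy by (simp flip: ennreal_mult)
      also have "\<dots> \<le> E * (\<integral>\<^sup>+ t. h t * indicator {y j <.. 2 * y j} t \<partial>lborel)"
        by (rule mult_left_mono[OF le]) simp
      finally show ?thesis using True by (simp add: y_def)
    qed simp
    then have "?L \<le> (\<integral>\<^sup>+ j. E * (\<integral>\<^sup>+ t. h t * indicator {y j <.. 2 * y j} t \<partial>lborel) \<partial>count_space UNIV)"
      by (intro nn_integral_mono)
    also have "\<dots> = E * (\<integral>\<^sup>+ j. (\<integral>\<^sup>+ t. h t * indicator {y j <.. 2 * y j} t \<partial>lborel) \<partial>count_space UNIV)"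
      by (simp add: nn_integral_cmult)
    also have "\<dots> = E * (\<integral>\<^sup>+ t. (\<integral>\<^sup>+ j. h t * indicator {y j <.. 2 * y j} t \<partial>count_space UNIV) \<partial>lborel)"
      by (subst nn_integral_count_space_nn_integral) auto
    also have "\<dots> \<le> E * (\<integral>\<^sup>+ t. h t \<partial>lborel)"
    proof (intro mult_left_mono nn_integral_mono)
      fix t :: real
      have "j = j'" if "t \<in> {y j <.. 2 * y j}" "t \<in> {y j' <.. 2 * y j'}" for j j'
      proof -
        have "\<not> i < i'" if "t \<in> {y i <.. 2 * y i}" "t \<in> {y i' <.. 2 * y i'}" for i i'
        proof
          assume "i < i'"
          then have "2 * (2::real) powr real_of_int i \<le> 2 powr real_of_int i'"
            using powr_mono[of "1 + real_of_int i" "real_of_int i'" 2] by (simp add: powr_add)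
          then have "2 * g / 2 powr real_of_int i' \<le> 2 * g / (2 * 2 powr real_of_int i)"
            using g by (intro divide_left_mono) auto
          then have "2 * y i' \<le> y i" by (simp add: y_def)
          then show False using that by auto
        qed
        then show ?thesis using that by (metis linorder_neqE)
      qed
      then obtain j0 where "\<And>j. t \<in> {y j <.. 2 * y j} \<Longrightarrow> j \<in> {j0}" by (metis singletonI)
      from count_indicator_le[OF _ _ this, of 1]
      have "(\<integral>\<^sup>+ j. indicator {j. t \<in> {y j <.. 2 * y j}} j \<partial>count_space UNIV) \<le> 1" by simp
      then have "h t * (\<integral>\<^sup>+ j. indicator {y j <.. 2 * y j} t \<partial>count_space UNIV) \<le> h t * 1"
        by (intro mult_left_mono) (auto simp: indicator_def)
      then show "(\<integral>\<^sup>+ j. h t * indicator {y j <.. 2 * y j} t \<partial>count_space UNIV) \<le> h t"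
        by (simp add: nn_integral_cmult)
    qed simp
    also have "\<dots> = ennreal (2 * 2 powr p * g powr p * J)"
      using J by (simp add: E_def ennreal_mult)
    also have "\<dots> \<le> ennreal (c * g powr p)"
      unfolding c_def by (intro ennreal_leI) (simp add: mult_ac mult_right_mono)
    finally show ?thesis .
  qed
  moreover have "0 < c" using J by (simp add: c_def add_nonneg_pos)
  ultimately show ?thesis using that by blast
qed

section \<open>Dyadic cubes\<close>

text \<open>Closed dyadic cubes are used because averages are taken over closed cubes. Neighbours then
  share faces, which may carry mass of the measure, so the cubes of one generation overlap; the overlap is
  bounded, and this suffices.\<close>

definition dyadic_centre :: "int \<Rightarrow> ('d \<Rightarrow> int) \<Rightarrow> real ^ 'd" where
  "dyadic_centre k m = (\<chi> i. (real_of_int (m i) + 1 / 2) * 2 powr real_of_int k)"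

definition dyadic_cube :: "int \<Rightarrow> ('d \<Rightarrow> int) \<Rightarrow> (real ^ 'd) set" where
  "dyadic_cube k m = cube (dyadic_centre k m) (2 powr real_of_int k)"

lemma mem_cube: "x \<in> cube c l \<longleftrightarrow> (\<forall>i. c $ i - l / 2 \<le> x $ i \<and> x $ i \<le> c $ i + l / 2)"
  by (simp add: cube_def mem_box_cart)

lemma cube_borel [measurable]: "cube c l \<in> sets borel"
  by (simp add: cube_def)

lemma mem_dyadic_cube:
  "x \<in> dyadic_cube k m \<longleftrightarrow> (\<forall>i. real_of_int (m i) \<le> x $ i / 2 powr real_of_int k
      \<and> x $ i / 2 powr real_of_int k \<le> real_of_int (m i) + 1)"
proof -
  define s where "s = (2::real) powr real_of_int k"
  have s: "0 < s" by (simp add: s_def)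
  have "(a + 1 / 2) * s - s / 2 = a * s" "(a + 1 / 2) * s + s / 2 = (a + 1) * s" for a
    by (simp_all add: algebra_simps)
  then show ?thesis
    using s by (simp add: dyadic_cube_def dyadic_centre_def mem_cube pos_le_divide_eq
        pos_divide_le_eq flip: s_def)
qed

text \<open>In each coordinate a point lies in at most two of the closed intervals of a given
  generation, which gives \<open>2 ^ d\<close> for the product.\<close>

lemma dyadic_cube_overlap:
  fixes x :: "real ^ 'd"
  shows "(\<integral>\<^sup>+ m. indicator (dyadic_cube k m) x \<partial>count_space UNIV) \<le> ennreal (2 ^ CARD('d))"
proof -
  define f where "f i = \<lfloor>x $ i / 2 powr real_of_int k\<rfloor>" for i
  let ?S = "PiE (UNIV :: 'd set) (\<lambda>i. {f i - 1, f i})"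
  have "card ?S = 2 ^ CARD('d)" "finite ?S"
    by (auto simp: card_PiE numeral_2_eq_2 intro!: finite_PiE)
  moreover have "m \<in> ?S" if "x \<in> dyadic_cube k m" for m
  proof -
    have "m i \<in> {f i - 1, f i}" for i
    proof -
      have "real_of_int (m i) \<le> x $ i / 2 powr real_of_int k"
        "x $ i / 2 powr real_of_int k \<le> real_of_int (m i) + 1"
        using that by (auto simp: mem_dyadic_cube)
      then have "m i \<le> f i" "f i \<le> m i + 1" unfolding f_def by linarith+
      then show ?thesis by auto
    qed
    then show ?thesis by auto
  qed
  ultimately have "(\<integral>\<^sup>+ m. indicator {m. x \<in> dyadic_cube k m} m \<partial>count_space UNIV)
      \<le> ennreal (real (2 ^ CARD('d)))"
    by (intro count_indicator_le[of ?S]) auto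
  then show ?thesis by (simp add: indicator_def)
qed

text \<open>Take the generation whose side is comparable with \<open>l\<close> and at least \<open>l\<close>. In each coordinate
  the cube meets only the interval containing its left end and the next one, and the triple of
  either interval contains both.\<close>

lemma cube_dyadic_cover:
  fixes c :: "real ^ 'd"
  assumes "0 < l"
  obtains k M where "finite M" "M \<noteq> {}" "card M \<le> 2 ^ CARD('d)"
    "l \<le> 2 powr real_of_int k" "2 powr real_of_int k \<le> 2 * l"
    "cube c l \<subseteq> (\<Union>m\<in>M. dyadic_cube k m)"
    "\<And>m. m \<in> M \<Longrightarrow> cube c l \<subseteq> cube (dyadic_centre k m) (3 * 2 powr real_of_int k)"
proof -
  define k where "k = \<lceil>log 2 l\<rceil>"
  define s where "s = (2::real) powr real_of_int k"
  have s0: "0 < s" by (simp add: s_def)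
  have "log 2 l \<le> real_of_int k" "real_of_int k \<le> 1 + log 2 l" unfolding k_def by linarith+
  then have s: "l \<le> s" "s \<le> 2 * l"
    using assms powr_mono[of "real_of_int k" "1 + log 2 l" 2] by (auto simp: s_def log_le_iff powr_add)
  define f where "f i = \<lfloor>(c $ i - l / 2) / s\<rfloor>" for i
  have f: "real_of_int (f i) * s \<le> c $ i - l / 2" "c $ i - l / 2 < (real_of_int (f i) + 1) * s" for i
  proof -
    have "real_of_int (f i) \<le> (c $ i - l / 2) / s" "(c $ i - l / 2) / s < real_of_int (f i) + 1"
      unfolding f_def by linarith+
    then show "real_of_int (f i) * s \<le> c $ i - l / 2" "c $ i - l / 2 < (real_of_int (f i) + 1) * s"
      using s0 by (auto simp: field_simps)
  qed
  let ?M = "PiE (UNIV :: 'd set) (\<lambda>i. {f i, f i + 1})"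
  show ?thesis
  proof
    show "finite ?M" "?M \<noteq> {}" "card ?M \<le> 2 ^ CARD('d)"
      by (auto simp: card_PiE PiE_eq_empty_iff intro!: finite_PiE)
    show "l \<le> 2 powr real_of_int k" "2 powr real_of_int k \<le> 2 * l" using s by (auto simp: s_def)
    show "cube c l \<subseteq> (\<Union>m\<in>?M. dyadic_cube k m)"
    proof
      fix x assume x: "x \<in> cube c l"
      define m where "m i = \<lfloor>x $ i / s\<rfloor>" for i
      have "m i \<in> {f i, f i + 1}" for i
      proof -
        have "c $ i - l / 2 \<le> x $ i" "x $ i \<le> c $ i - l / 2 + s" using x s by (auto simp: mem_cube dest: spec[of _ i])
        then have "(c $ i - l / 2) / s \<le> x $ i / s" "x $ i / s \<le> (c $ i - l / 2) / s + 1"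
          using s0 divide_right_mono[of "c $ i - l / 2" "x $ i" s]
            divide_right_mono[of "x $ i" "c $ i - l / 2 + s" s]
          by (auto simp: add_divide_distrib)
        then have "f i \<le> m i" "m i \<le> f i + 1" unfolding f_def m_def by linarith+
        then show ?thesis by auto
      qed
      moreover have "x \<in> dyadic_cube k m"
        unfolding mem_dyadic_cube m_def s_def by (auto intro: less_imp_le)
      ultimately show "x \<in> (\<Union>m\<in>?M. dyadic_cube k m)" by (auto simp: PiE_def)
    qed
    show "cube c l \<subseteq> cube (dyadic_centre k m) (3 * 2 powr real_of_int k)" if m: "m \<in> ?M" for m
    proof
      fix x assume x: "x \<in> cube c l"
      have "(real_of_int (m i) - 1) * s \<le> x $ i \<and> x $ i \<le> (real_of_int (m i) + 2) * s" for i
      proof -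
        have "m i \<in> {f i, f i + 1}" using m by auto
        moreover have "c $ i - l / 2 \<le> x $ i" "x $ i \<le> c $ i - l / 2 + s"
          using x s by (auto simp: mem_cube dest: spec[of _ i])
        ultimately show ?thesis using f[of i] s0 by (auto simp: algebra_simps)
      qed
      then show "x \<in> cube (dyadic_centre k m) (3 * 2 powr real_of_int k)"
        by (simp add: mem_cube dyadic_centre_def algebra_simps flip: s_def)
    qed
  qed
qed



section \<open>Inequalities for Luxemburg averages\<close>

text \<open>Luxemburg averages are estimated through numbers strictly above them; this lemma passes to the
  limit, including the case of an infinite average.\<close>

lemma le_mult_of_greater:
  fixes X L :: ennreal
  assumes "0 < D" "\<And>s. L < ennreal s \<Longrightarrow> X \<le> ennreal (D * s)"
  shows "X \<le> ennreal D * L"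
proof (cases L)
  case (real r)
  show ?thesis
  proof (rule ennreal_le_epsilon)
    fix e :: real assume "0 < e"
    then have "X \<le> ennreal (D * (r + e / D))"
      using real assms(1) by (intro assms(2)) (simp add: ennreal_less_iff)
    also have "\<dots> = ennreal D * L + ennreal e"
      using real assms(1) \<open>0 < e\<close> by (simp add: distrib_left flip: ennreal_mult ennreal_plus)
    finally show "X \<le> ennreal D * L + ennreal e" .
  qed
qed (use assms(1) in \<open>simp add: ennreal_mult_top\<close>)

text \<open>Among the at most \<open>2 ^ d\<close> dyadic cubes covering \<open>Q\<close>, choose the one with the largest average.
  Every number above that average bounds the modular over each of them, hence over \<open>Q\<close>, up to the
  number of cubes and the ratio \<open>2 powr n\<close> of the normalizations.\<close>

lemma lux_avg_le_dyadic:
  fixes \<mu> :: "(real ^ 'd) measure"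
  assumes B: "young B" and sets: "sets \<mu> = sets borel"
    and g [measurable]: "g \<in> borel_measurable \<mu>" and l: "0 < l" and n: "0 < n"
  obtains k m where "l \<le> 2 powr real_of_int k"
    "cube c l \<subseteq> cube (dyadic_centre k m) (3 * 2 powr real_of_int k)"
    "lux_avg \<mu> n B c l g \<le> ennreal (2 ^ CARD('d) * 2 powr n)
       * lux_avg \<mu> n B (dyadic_centre k m) (2 powr real_of_int k) g"
proof -
  note [measurable] = B
  note [measurable_cong] = sets
  obtain k M where M: "finite M" "M \<noteq> {}" "card M \<le> 2 ^ CARD('d)"
    and l_le: "l \<le> 2 powr real_of_int k" and le_l: "2 powr real_of_int k \<le> 2 * l"
    and cover: "cube c l \<subseteq> (\<Union>m\<in>M. dyadic_cube k m)"
    and sub: "\<And>m. m \<in> M \<Longrightarrow> cube c l \<subseteq> cube (dyadic_centre k m) (3 * 2 powr real_of_int k)"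
    using cube_dyadic_cover[OF l, of c] by metis
  let ?s = "2 powr real_of_int k"
  define L where "L m = lux_avg \<mu> n B (dyadic_centre k m) ?s g" for m
  have "Max (L ` M) \<in> L ` M" using M by (intro Max_in) auto
  then obtain m where m: "m \<in> M" and "L m = Max (L ` M)" by (metis imageE)
  then have max: "L m' \<le> L m" if "m' \<in> M" for m'
    using that M by simp
  define R where "R = 2 ^ CARD('d) * 2 powr n"
  have R: "1 \<le> R"
    unfolding R_def using n by (intro mult_ge1_I) (auto intro: ge_one_powr_ge_zero)
  have "lux_avg \<mu> n B c l g \<le> ennreal R * L m"
  proof (rule le_mult_of_greater)
    fix t assume t: "L m < ennreal t"
    have t0: "0 < t" using t by (metis ennreal_neg not_le not_less_zero)
    have "(\<integral>\<^sup>+ x\<in>cube c l. young_ext B (g x / ennreal t) \<partial>\<mu>)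
        \<le> (\<integral>\<^sup>+ x. (\<Sum>m\<in>M. young_ext B (g x / ennreal t) * indicator (dyadic_cube k m) x) \<partial>\<mu>)"
    proof (intro nn_integral_mono)
      fix x
      show "young_ext B (g x / ennreal t) * indicator (cube c l) x
          \<le> (\<Sum>m\<in>M. young_ext B (g x / ennreal t) * indicator (dyadic_cube k m) x)"
      proof (cases "x \<in> cube c l")
        case True
        then obtain m' where "m' \<in> M" "x \<in> dyadic_cube k m'" using cover by auto
        then show ?thesis
          using member_le_sum[of m' M "\<lambda>m. young_ext B (g x / ennreal t) * indicator (dyadic_cube k m) x"] M
            True by simp
      qed simp
    qed
    also have "\<dots> = (\<Sum>m\<in>M. \<integral>\<^sup>+ x\<in>dyadic_cube k m. young_ext B (g x / ennreal t) \<partial>\<mu>)"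
      by (rule nn_integral_sum) (simp add: dyadic_cube_def)
    also have "\<dots> \<le> (\<Sum>m\<in>M. ennreal (?s powr n))"
    proof (rule sum_mono)
      fix m' assume "m' \<in> M"
      then have "L m' < ennreal t" using max t by (meson le_less_trans)
      then show "(\<integral>\<^sup>+ x\<in>dyadic_cube k m'. young_ext B (g x / ennreal t) \<partial>\<mu>) \<le> ennreal (?s powr n)"
        unfolding dyadic_cube_def L_def by (intro lux_avg_lessD[OF B]) auto
    qed
    also have "\<dots> = ennreal (real (card M) * ?s powr n)"
      by (simp add: ennreal_of_nat_eq_real_of_nat ennreal_mult)
    also have "\<dots> \<le> ennreal (R * l powr n)"
    proof (rule ennreal_leI)
      have "?s powr n \<le> (2 * l) powr n" using le_l n by (intro powr_mono2) auto
      also have "\<dots> = 2 powr n * l powr n" using l by (simp add: powr_mult)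
      finally have "real (card M) * ?s powr n \<le> 2 ^ CARD('d) * (2 powr n * l powr n)"
        using M(3) by (intro mult_mono) (auto simp: of_nat_le_iff[symmetric] simp del: of_nat_le_iff)
      then show "real (card M) * ?s powr n \<le> R * l powr n" by (simp add: R_def mult.assoc)
    qed
    finally show "lux_avg \<mu> n B c l g \<le> ennreal (R * t)"
      by (intro lux_avg_leI[OF B l t0 R sets g])
  qed (use R in simp)
  then show ?thesis using that[OF l_le sub[OF m]] by (simp add: L_def R_def)
qed

text \<open>The generalized Hoelder inequality for Luxemburg averages: integrate the pointwise Young inequality.
  The constant summand \<open>t0\<close> in the latter contributes \<open>t0 \<mu>(Q)\<close>, which the growth condition on the
  measure absorbs. The factor \<open>w\<close> is represented by a positive number \<open>t\<close> above its average rather than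
  by the average itself; this avoids the product of \<open>0\<close> and \<open>\<infinity>\<close>. Where \<open>w\<close> is infinite, so is the
  right side of the Young inequality, which is why \<open>h\<close> is compared with \<open>g w\<close> only elsewhere.\<close>

lemma lux_avg_holder:
  assumes A: "young A" and B: "young B" and C: "young C"
    and dom: "(\<lambda>t. young_inv A t * young_inv C t) \<preceq> young_inv B"
  obtains D where "0 < D"
    "\<And>(\<mu> :: (real ^ 'd) measure) n c l h g w t. upper_ahlfors n \<mu> \<Longrightarrow> 0 < l \<Longrightarrow>
      h \<in> borel_measurable \<mu> \<Longrightarrow> g \<in> borel_measurable \<mu> \<Longrightarrow> w \<in> borel_measurable \<mu> \<Longrightarrow>
      (\<And>x. w x < top \<Longrightarrow> h x \<le> g x * w x) \<Longrightarrow> lux_avg \<mu> n A c l w < ennreal t \<Longrightarrow>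
      lux_avg \<mu> n B c l h \<le> ennreal (D * t) * lux_avg \<mu> n C c l g"
proof -
  obtain a t0 where a: "0 < a" and t0: "0 < t0"
    and young: "\<And>x y. 0 \<le> x \<Longrightarrow> 0 \<le> y \<Longrightarrow> B (x * y / a) \<le> A x + C y + t0"
    using young_inequality[OF A B C dom] by blast
  \<comment> \<open>One unit for each of the two modulars, and \<open>t0\<close> for the constant summand.\<close>
  define R where "R = 2 + t0"
  have "lux_avg \<mu> n B c l h \<le> ennreal (R * a * t) * lux_avg \<mu> n C c l g"
    if ahlfors: "upper_ahlfors n \<mu>" and l: "0 < l"
      and [measurable]: "h \<in> borel_measurable \<mu>" "g \<in> borel_measurable \<mu>" "w \<in> borel_measurable \<mu>"
      and le: "\<And>x. w x < top \<Longrightarrow> h x \<le> g x * w x" and t: "lux_avg \<mu> n A c l w < ennreal t"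
    for \<mu> :: "(real ^ 'd) measure" and n c l h g w t
  proof -
    note [measurable] = A B C
    have sets [measurable_cong]: "sets \<mu> = sets borel" and meas: "emeasure \<mu> (cube c l) \<le> ennreal (l powr n)"
      using ahlfors l by (auto simp: upper_ahlfors_def)
    have tpos: "0 < t" using t by (metis ennreal_neg not_le not_less_zero)
    show ?thesis
    proof (rule le_mult_of_greater)
      show "0 < R * a * t" using a t0 tpos by (simp add: R_def)
      fix s assume s: "lux_avg \<mu> n C c l g < ennreal s"
      have spos: "0 < s" using s by (metis ennreal_neg not_le not_less_zero)
      have pointwise: "young_ext B (h x / ennreal (a * t * s))
          \<le> young_ext A (w x / ennreal t) + young_ext C (g x / ennreal s) + ennreal t0" for x
      proof (cases "w x = top \<or> g x = top")
        case True
        then show ?thesis by (auto simp: young_ext_def ennreal_top_divide)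
      next
        case False
        then obtain y z where y: "w x = ennreal y" "0 \<le> y" and z: "g x = ennreal z" "0 \<le> z"
          by (cases "w x"; cases "g x") auto
        have "h x / ennreal (a * t * s) \<le> ennreal (z * y) / ennreal (a * t * s)"
          using le[of x] y z by (intro divide_right_mono_ennreal) (simp add: ennreal_mult)
        also have "\<dots> = ennreal ((y / t) * (z / s) / a)"
          using y z a tpos spos by (simp add: divide_ennreal field_simps)
        finally have "young_ext B (h x / ennreal (a * t * s)) \<le> young_ext B (ennreal ((y / t) * (z / s) / a))"
          by (rule young_ext_mono[OF B])
        also have "\<dots> = ennreal (B ((y / t) * (z / s) / a))"
          using y z a tpos spos by (simp add: young_ext_def)
        also have "\<dots> \<le> ennreal (A (y / t) + C (z / s) + t0)"
          using y z tpos spos by (intro ennreal_leI young) auto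
        also have "\<dots> = young_ext A (w x / ennreal t) + young_ext C (g x / ennreal s) + ennreal t0"
          using y z tpos spos t0 young_nonneg[OF A] young_nonneg[OF C]
          by (simp add: young_ext_def divide_ennreal)
        finally show ?thesis .
      qed
      have "(\<integral>\<^sup>+ x\<in>cube c l. young_ext B (h x / ennreal (a * t * s)) \<partial>\<mu>)
          \<le> (\<integral>\<^sup>+ x. young_ext A (w x / ennreal t) * indicator (cube c l) x
              + young_ext C (g x / ennreal s) * indicator (cube c l) x
              + ennreal t0 * indicator (cube c l) x \<partial>\<mu>)"
        by (intro nn_integral_mono)
          (use mult_right_mono[OF pointwise] in \<open>auto simp: distrib_right\<close>)
      also have "\<dots> = (\<integral>\<^sup>+ x\<in>cube c l. young_ext A (w x / ennreal t) \<partial>\<mu>)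
          + (\<integral>\<^sup>+ x\<in>cube c l. young_ext C (g x / ennreal s) \<partial>\<mu>)
          + (\<integral>\<^sup>+ x\<in>cube c l. ennreal t0 \<partial>\<mu>)"
        by (simp add: nn_integral_add)
      also have "\<dots> \<le> ennreal (l powr n) + ennreal (l powr n) + ennreal t0 * ennreal (l powr n)"
        using lux_avg_lessD[OF A l t] lux_avg_lessD[OF C l s] meas
        by (intro add_mono) (auto simp: nn_integral_cmult_indicator intro!: mult_left_mono)
      also have "\<dots> = ennreal (R * l powr n)"
        using t0 by (simp add: R_def distrib_right flip: ennreal_mult ennreal_plus)
      finally have "lux_avg \<mu> n B c l h \<le> ennreal (R * (a * t * s))"
        using a tpos spos t0 by (intro lux_avg_leI[OF B l _ _ sets]) (auto simp: R_def)
      then show "lux_avg \<mu> n B c l h \<le> ennreal (R * a * t * s)" by (simp add: mult.assoc)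
    qed
  qed
  moreover have "0 < R * a" using a t0 by (simp add: R_def)
  ultimately show ?thesis using that[of "R * a"] by blast
qed



section \<open>The sum over all dyadic cubes\<close>

text \<open>The heart of the proof. For \<open>p = q\<close> the sum over all dyadic cubes diverges in general; for
  \<open>q > p\<close> it converges by an argument in the style of Marcinkiewicz interpolation. Write \<open>r = q / p\<close>
  and fix a height \<open>2 powr j\<close>. If the average of \<open>g\<close> over \<open>P\<close> exceeds it, then, because \<open>\<mu>(P)\<close> is at
  most \<open>l(P) powr n\<close>, the part of \<open>C (g / 2 powr j)\<close> coming from the large values of \<open>g\<close> has an integral
  over \<open>P\<close> greater than \<open>l(P) powr n / 2\<close>. Let \<open>H\<^sub>j\<close> be the integral of that part over the whole space.
  Cubes of one generation overlap boundedly, so at most a multiple of \<open>H\<^sub>j / l powr n\<close> cubes of side \<open>l\<close>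
  qualify, and none unless \<open>l powr n < 2 H\<^sub>j\<close>. Summing the weights \<open>l powr (n r)\<close> over generations is
  therefore a geometric sum with exponent \<open>n (r - 1) > 0\<close>, of size \<open>H\<^sub>j powr r\<close>. Summing over \<open>j\<close> with
  weights \<open>2 powr (q j) = (2 powr (p j)) powr r\<close> leaves the \<open>r\<close>-th power of a sum that the \<open>B\<^sub>p\<close>
  condition bounds by the integral of \<open>g powr p\<close>.\<close>

lemma dyadic_carleson:
  assumes C: "young C" and Bp: "B_cond p C" and n: "0 < n" and p: "1 < p" and q: "p < q"
  obtains c where "0 < c"
    "\<And>(\<mu> :: (real ^ 'd) measure) g. upper_ahlfors n \<mu> \<Longrightarrow> g \<in> borel_measurable \<mu> \<Longrightarrow> (\<And>x. 0 \<le> g x) \<Longrightarrow>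
      (\<integral>\<^sup>+ k. \<integral>\<^sup>+ m. ennreal (2 powr (n * (q / p) * real_of_int k))
         * lux_avg \<mu> n C (dyadic_centre k m) (2 powr real_of_int k) (\<lambda>x. ennreal (g x)) epowr q
         \<partial>count_space UNIV \<partial>count_space UNIV)
      \<le> ennreal c * (\<integral>\<^sup>+ x. ennreal (g x powr p) \<partial>\<mu>) epowr (q / p)"
proof -
  define r where "r = q / p"
  have r: "1 < r" using p q by (simp add: r_def)
  \<comment> \<open>Values of \<open>g\<close> below \<open>s0 * 2 powr j\<close> contribute at most half of the admissible modular.\<close>
  define s0 where "s0 = 1 / (2 * (C 1 + 1))"
  have C1: "0 \<le> C 1" using C by (simp add: young_nonneg)
  then have s0: "0 < s0" "s0 \<le> 1" by (auto simp: s0_def field_simps)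
  have Cs0: "C s0 \<le> 1 / 2"
  proof -
    have "C (s0 * 1) \<le> s0 * C 1" using s0 by (intro young_scale[OF C]) auto
    also have "\<dots> \<le> 1 / 2" using C1 by (simp add: s0_def field_simps)
    finally show ?thesis by simp
  qed
  obtain c1 where c1: "0 < c1" and geom: "\<And>X :: ennreal.
      (\<integral>\<^sup>+ k. ennreal (2 powr (n * (r - 1) * real_of_int k))
        * indicator {k. ennreal (2 powr (n * real_of_int k)) < X} k \<partial>count_space UNIV)
      \<le> ennreal c1 * X epowr (r - 1)"
    using dyadic_geometric_sum[of "n * (r - 1)" n] n r by auto
  obtain c2 where c2: "0 < c2" and dini: "\<And>g. 0 \<le> g \<Longrightarrow>
      (\<integral>\<^sup>+ j. ennreal (2 powr (p * real_of_int j)) *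
        ennreal (if s0 * 2 powr real_of_int j < g then C (g / 2 powr real_of_int j) else 0) \<partial>count_space UNIV)
      \<le> ennreal (c2 * g powr p)"
    using B_cond_dyadic_sum[OF C Bp s0(1)] by blast
  define c3 where "c3 = 2 powr q * (2 * 2 ^ CARD('d)) * (c1 * 2 powr (r - 1))"
  define c where "c = c3 * c2 powr r"
  have "(\<integral>\<^sup>+ k. \<integral>\<^sup>+ m. ennreal (2 powr (n * r * real_of_int k))
         * lux_avg \<mu> n C (dyadic_centre k m) (2 powr real_of_int k) (\<lambda>x. ennreal (g x)) epowr q
         \<partial>count_space UNIV \<partial>count_space UNIV)
      \<le> ennreal c * (\<integral>\<^sup>+ x. ennreal (g x powr p) \<partial>\<mu>) epowr r"
    if ahlfors: "upper_ahlfors n \<mu>" and [measurable]: "g \<in> borel_measurable \<mu>" and g: "\<And>x. 0 \<le> g x"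
    for \<mu> :: "(real ^ 'd) measure" and g
  proof -
    have sets [measurable_cong]: "sets \<mu> = sets borel"
      and ball: "\<And>c l. 0 < l \<Longrightarrow> emeasure \<mu> (cube c l) \<le> ennreal (l powr n)"
      using ahlfors by (auto simp: upper_ahlfors_def)
    note [measurable] = C borel_measurable_young[OF C]
    have [measurable]: "dyadic_cube k m \<in> sets borel" for k and m :: "'d \<Rightarrow> int"
      by (simp add: dyadic_cube_def)
    define L where "L k m = lux_avg \<mu> n C (dyadic_centre k m) (2 powr real_of_int k) (\<lambda>x. ennreal (g x))"
      for k m
    define G where "G j x = ennreal (if s0 * 2 powr real_of_int j < g x
        then C (max 0 (g x / 2 powr real_of_int j)) else 0)" for j x
    have [measurable]: "G j \<in> borel_measurable \<mu>" for j unfolding G_def by measurable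
    define H where "H j = (\<integral>\<^sup>+ x. G j x \<partial>\<mu>)" for j
    define I where "I j k m = (\<integral>\<^sup>+ x\<in>dyadic_cube k m. G j x \<partial>\<mu>)" for j k m

    have level: "ennreal (2 powr (n * real_of_int k)) < 2 * I j k m"
      if "ennreal (2 powr real_of_int j) < L k m" for j k m
    proof (rule ccontr)
      assume "\<not> ?thesis"
      then have small: "2 * I j k m \<le> ennreal ((2 powr real_of_int k) powr n)"
        by (simp add: powr_powr mult.commute not_less)
      have halves: "ennreal (1 / 2) * y + ennreal (1 / 2) * y = y" for y
      proof -
        have "ennreal (1 / 2) + ennreal (1 / 2) = ennreal (1 / 2 + 1 / 2)"
          by (rule ennreal_plus[symmetric]) auto
        also have "\<dots> = 1" by simp
        finally show ?thesis by (metis distrib_right mult_1_left)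
      qed
      have "young_ext C (ennreal (g x) / ennreal (2 powr real_of_int j)) \<le> ennreal (1 / 2) + G j x" for x
      proof (cases "s0 * 2 powr real_of_int j < g x")
        case True
        then show ?thesis using g by (simp add: G_def young_ext_def divide_ennreal)
      next
        case False
        then have "C (g x / 2 powr real_of_int j) \<le> C s0"
          using g by (intro young_mono[OF C]) (auto simp: field_simps)
        with Cs0 have "ennreal (C (g x / 2 powr real_of_int j)) \<le> ennreal (1 / 2)"
          by (intro ennreal_leI) linarith
        then show ?thesis using g False by (simp add: G_def young_ext_def divide_ennreal)
      qed
      then have "(\<integral>\<^sup>+ x\<in>dyadic_cube k m. young_ext C (ennreal (g x) / ennreal (2 powr real_of_int j)) \<partial>\<mu>)
          \<le> (\<integral>\<^sup>+ x. ennreal (1 / 2) * indicator (dyadic_cube k m) x + G j x * indicator (dyadic_cube k m) x \<partial>\<mu>)"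
        by (intro nn_integral_mono) (auto simp: indicator_def)
      also have "\<dots> = ennreal (1 / 2) * emeasure \<mu> (dyadic_cube k m) + I j k m"
        unfolding I_def by (subst nn_integral_add) (auto simp: nn_integral_cmult_indicator)
      also have "\<dots> \<le> ennreal (1 / 2) * ennreal ((2 powr real_of_int k) powr n)
          + ennreal (1 / 2) * ennreal ((2 powr real_of_int k) powr n)"
      proof (intro add_mono mult_left_mono)
        show "emeasure \<mu> (dyadic_cube k m) \<le> ennreal ((2 powr real_of_int k) powr n)"
          unfolding dyadic_cube_def by (intro ball) simp
        have "ennreal (1 / 2) * (2 * I j k m) = I j k m"
          by (simp only: mult_2 distrib_left halves)
        then show "I j k m \<le> ennreal (1 / 2) * ennreal ((2 powr real_of_int k) powr n)"
          using mult_left_mono[OF small, of "ennreal (1 / 2)"] by simp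
      qed simp
      also have "\<dots> = ennreal (1 * (2 powr real_of_int k) powr n)"
        by (simp only: halves mult_1_left)
      finally have "L k m \<le> ennreal (1 * 2 powr real_of_int j)"
        unfolding L_def dyadic_cube_def by (intro lux_avg_leI[OF C _ _ _ sets]) auto
      then show False using that by simp
    qed
    have I_le: "I j k m \<le> H j" for j k m
      unfolding I_def H_def by (intro nn_integral_mono) (auto simp: indicator_def)
    have sum_I: "(\<integral>\<^sup>+ m. I j k m \<partial>count_space UNIV) \<le> ennreal (2 ^ CARD('d)) * H j" for j k
    proof -
      have "(\<integral>\<^sup>+ m. I j k m \<partial>count_space UNIV)
          = (\<integral>\<^sup>+ x. (\<integral>\<^sup>+ m. G j x * indicator (dyadic_cube k m) x \<partial>count_space UNIV) \<partial>\<mu>)"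
        unfolding I_def by (subst nn_integral_count_space_nn_integral) auto
      also have "\<dots> = (\<integral>\<^sup>+ x. G j x * (\<integral>\<^sup>+ m. indicator (dyadic_cube k m) x \<partial>count_space UNIV) \<partial>\<mu>)"
        by (simp add: nn_integral_cmult)
      also have "\<dots> \<le> (\<integral>\<^sup>+ x. G j x * ennreal (2 ^ CARD('d)) \<partial>\<mu>)"
        by (intro nn_integral_mono mult_left_mono dyadic_cube_overlap) simp
      also have "\<dots> = ennreal (2 ^ CARD('d)) * H j"
        by (simp add: nn_integral_multc H_def mult.commute)
      finally show ?thesis .
    qed
    have one_level: "(\<integral>\<^sup>+ k. \<integral>\<^sup>+ m. ennreal (2 powr (n * r * real_of_int k))
          * indicator {j. ennreal (2 powr real_of_int j) < L k m} j \<partial>count_space UNIV \<partial>count_space UNIV)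
        \<le> ennreal (2 * 2 ^ CARD('d) * (c1 * 2 powr (r - 1))) * H j epowr r" (is "?S \<le> _") for j
    proof -
      define W where "W k = ennreal (2 powr (n * (r - 1) * real_of_int k))
          * indicator {k. ennreal (2 powr (n * real_of_int k)) < 2 * H j} k" for k
      have "ennreal (2 powr (n * r * real_of_int k)) * indicator {j. ennreal (2 powr real_of_int j) < L k m} j
          \<le> W k * 2 * I j k m" for k m
      proof (cases "ennreal (2 powr real_of_int j) < L k m")
        case True
        note lev = level[OF True]
        also have "2 * I j k m \<le> 2 * H j" by (intro mult_left_mono I_le) simp
        finally have W: "W k = ennreal (2 powr (n * (r - 1) * real_of_int k))" by (simp add: W_def)
        have "ennreal (2 powr (n * r * real_of_int k))
            = ennreal (2 powr (n * (r - 1) * real_of_int k)) * ennreal (2 powr (n * real_of_int k))"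
          by (simp add: algebra_simps flip: ennreal_mult powr_add)
        also have "\<dots> \<le> ennreal (2 powr (n * (r - 1) * real_of_int k)) * (2 * I j k m)"
          using level[OF True] by (intro mult_left_mono) auto
        finally show ?thesis using True by (simp add: W mult.assoc)
      qed simp
      then have "?S \<le> (\<integral>\<^sup>+ k. \<integral>\<^sup>+ m. W k * 2 * I j k m \<partial>count_space UNIV \<partial>count_space UNIV)"
        by (intro nn_integral_mono)
      also have "\<dots> = (\<integral>\<^sup>+ k. W k * 2 * (\<integral>\<^sup>+ m. I j k m \<partial>count_space UNIV) \<partial>count_space UNIV)"
        by (simp add: nn_integral_cmult)
      also have "\<dots> \<le> (\<integral>\<^sup>+ k. W k * 2 * (ennreal (2 ^ CARD('d)) * H j) \<partial>count_space UNIV)"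
        by (intro nn_integral_mono mult_left_mono sum_I) simp
      also have "\<dots> = (\<integral>\<^sup>+ k. W k \<partial>count_space UNIV) * (2 * (ennreal (2 ^ CARD('d)) * H j))"
        by (simp add: nn_integral_multc mult.assoc)
      also have "\<dots> \<le> (ennreal c1 * (2 * H j) epowr (r - 1)) * (2 * (ennreal (2 ^ CARD('d)) * H j))"
        unfolding W_def by (intro mult_right_mono geom) simp
      also have "(2 * H j) epowr (r - 1) = ennreal (2 powr (r - 1)) * H j epowr (r - 1)"
        using epowr_ennreal[of 2 "r - 1"] by (simp add: epowr_mult)
      also have "(ennreal c1 * (ennreal (2 powr (r - 1)) * H j epowr (r - 1))) * (2 * (ennreal (2 ^ CARD('d)) * H j))
          = (2 * ennreal (2 ^ CARD('d)) * (ennreal c1 * ennreal (2 powr (r - 1)))) * (H j epowr 1 * H j epowr (r - 1))"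
        by (simp only: epowr_one mult_ac)
      also have "\<dots> = ennreal (2 * 2 ^ CARD('d) * (c1 * 2 powr (r - 1))) * H j epowr r"
        unfolding epowr_add[symmetric] using c1 by (simp add: ennreal_mult)
      finally show ?thesis .
    qed
    have sum_H: "(\<integral>\<^sup>+ j. ennreal (2 powr (p * real_of_int j)) * H j \<partial>count_space UNIV)
        \<le> ennreal c2 * (\<integral>\<^sup>+ x. ennreal (g x powr p) \<partial>\<mu>)"
    proof -
      have "(\<integral>\<^sup>+ j. ennreal (2 powr (p * real_of_int j)) * H j \<partial>count_space UNIV)
          = (\<integral>\<^sup>+ x. (\<integral>\<^sup>+ j. ennreal (2 powr (p * real_of_int j)) * G j x \<partial>count_space UNIV) \<partial>\<mu>)"
        unfolding H_def by (subst nn_integral_count_space_nn_integral) (auto simp: nn_integral_cmult)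
      also have "\<dots> \<le> (\<integral>\<^sup>+ x. ennreal c2 * ennreal (g x powr p) \<partial>\<mu>)"
      proof (intro nn_integral_mono)
        fix x
        have "G j x = ennreal (if s0 * 2 powr real_of_int j < g x then C (g x / 2 powr real_of_int j) else 0)" for j
          using g[of x] by (simp add: G_def)
        then show "(\<integral>\<^sup>+ j. ennreal (2 powr (p * real_of_int j)) * G j x \<partial>count_space UNIV)
            \<le> ennreal c2 * ennreal (g x powr p)"
          using dini[OF g[of x]] c2 by (simp add: ennreal_mult)
      qed
      also have "\<dots> = ennreal c2 * (\<integral>\<^sup>+ x. ennreal (g x powr p) \<partial>\<mu>)" by (simp add: nn_integral_cmult)
      finally show ?thesis .
    qed

    let ?T = "\<lambda>j k m. ennreal (2 powr (n * r * real_of_int k)) * indicator {j. ennreal (2 powr real_of_int j) < L k m} j"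
    have "(\<integral>\<^sup>+ k. \<integral>\<^sup>+ m. ennreal (2 powr (n * r * real_of_int k)) * L k m epowr q \<partial>count_space UNIV \<partial>count_space UNIV)
        \<le> (\<integral>\<^sup>+ k. \<integral>\<^sup>+ m. ennreal (2 powr (n * r * real_of_int k)) * (ennreal (2 powr q)
            * (\<integral>\<^sup>+ j. ennreal (2 powr (q * real_of_int j))
                * indicator {j. ennreal (2 powr real_of_int j) < L k m} j \<partial>count_space UNIV))
          \<partial>count_space UNIV \<partial>count_space UNIV)"
      using p q by (intro nn_integral_mono mult_left_mono epowr_le_dyadic_sum) auto
    also have "\<dots> = (\<integral>\<^sup>+ k. \<integral>\<^sup>+ m. \<integral>\<^sup>+ j. ennreal (2 powr q) * (ennreal (2 powr (q * real_of_int j)) * ?T j k m)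
          \<partial>count_space UNIV \<partial>count_space UNIV \<partial>count_space UNIV)"
      by (simp add: mult_ac flip: nn_integral_cmult)
    also have "\<dots> = (\<integral>\<^sup>+ j. \<integral>\<^sup>+ k. \<integral>\<^sup>+ m. ennreal (2 powr q) * (ennreal (2 powr (q * real_of_int j)) * ?T j k m)
          \<partial>count_space UNIV \<partial>count_space UNIV \<partial>count_space UNIV)"
    proof -
      have swap: "(\<integral>\<^sup>+ a. \<integral>\<^sup>+ b. F b a \<partial>count_space UNIV \<partial>count_space UNIV)
          = (\<integral>\<^sup>+ b. \<integral>\<^sup>+ a. F b a \<partial>count_space UNIV \<partial>count_space UNIV)"
        for F :: "int \<Rightarrow> 'x \<Rightarrow> ennreal"
        by (rule nn_integral_count_space_nn_integral) auto
      show ?thesis by (subst swap[symmetric], rule nn_integral_cong, rule swap)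
    qed
    also have "\<dots> = (\<integral>\<^sup>+ j. ennreal (2 powr q) * (ennreal (2 powr (q * real_of_int j))
          * (\<integral>\<^sup>+ k. \<integral>\<^sup>+ m. ?T j k m \<partial>count_space UNIV \<partial>count_space UNIV)) \<partial>count_space UNIV)"
      by (simp only: nn_integral_cmult borel_measurable_count_space)
    also have "\<dots> \<le> (\<integral>\<^sup>+ j. ennreal (2 powr q) * (ennreal (2 powr (q * real_of_int j))
          * (ennreal (2 * 2 ^ CARD('d) * (c1 * 2 powr (r - 1))) * H j epowr r)) \<partial>count_space UNIV)"
      by (intro nn_integral_mono mult_left_mono one_level) auto
    also have "\<dots> = (\<integral>\<^sup>+ j. ennreal c3 * (ennreal (2 powr (p * real_of_int j)) * H j) epowr r \<partial>count_space UNIV)"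
    proof (intro nn_integral_cong)
      fix j
      have "ennreal (2 powr (q * real_of_int j)) = ennreal (2 powr (p * real_of_int j)) epowr r"
        using p by (simp add: epowr_ennreal powr_powr r_def mult.commute)
      moreover have "ennreal c3 = ennreal (2 powr q) * ennreal (2 * 2 ^ CARD('d) * (c1 * 2 powr (r - 1)))"
        using c1 by (simp add: c3_def mult.assoc flip: ennreal_mult)
      ultimately show "ennreal (2 powr q) * (ennreal (2 powr (q * real_of_int j))
          * (ennreal (2 * 2 ^ CARD('d) * (c1 * 2 powr (r - 1))) * H j epowr r))
          = ennreal c3 * (ennreal (2 powr (p * real_of_int j)) * H j) epowr r"
        by (simp only: epowr_mult mult_ac)
    qed
    also have "\<dots> = ennreal c3 * (\<integral>\<^sup>+ j. (ennreal (2 powr (p * real_of_int j)) * H j) epowr r \<partial>count_space UNIV)"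
      by (simp add: nn_integral_cmult)
    also have "\<dots> \<le> ennreal c3 * (\<integral>\<^sup>+ j. ennreal (2 powr (p * real_of_int j)) * H j \<partial>count_space UNIV) epowr r"
      using r by (intro mult_left_mono sum_epowr_le) auto
    also have "\<dots> \<le> ennreal c3 * (ennreal c2 * (\<integral>\<^sup>+ x. ennreal (g x powr p) \<partial>\<mu>)) epowr r"
      using r by (intro mult_left_mono epowr_mono sum_H) auto
    also have "\<dots> = ennreal c * (\<integral>\<^sup>+ x. ennreal (g x powr p) \<partial>\<mu>) epowr r"
      using c1 c2 by (simp add: epowr_mult epowr_ennreal c_def c3_def ennreal_mult mult.assoc)
    finally show ?thesis by (simp add: L_def)
  qed
  moreover have "0 < c" using c1 c2 by (simp add: c_def c3_def)
  ultimately show ?thesis using that by (auto simp: r_def)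
qed



section \<open>The two-weight inequality\<close>

text \<open>The supremum over all cubes becomes a supremum over the triples of dyadic cubes, and a
  supremum of \<open>q\<close>-th powers is at most their sum.\<close>

lemma maximal_op_le_dyadic_sum:
  fixes \<mu> :: "(real ^ 'd) measure"
  assumes B: "young B" and sets: "sets \<mu> = sets borel" and [measurable]: "f \<in> borel_measurable \<mu>"
    and n: "0 < n" and \<alpha>: "0 \<le> \<alpha>" and q: "0 < q"
  shows "maximal_op \<mu> n \<alpha> B f x epowr q
    \<le> (\<integral>\<^sup>+ k. \<integral>\<^sup>+ m. (ennreal (2 ^ CARD('d) * 2 powr n) * (ennreal ((2 powr real_of_int k) powr \<alpha>)
          * lux_avg \<mu> n B (dyadic_centre k m) (2 powr real_of_int k) (\<lambda>y. ennreal \<bar>f y\<bar>))) epowr q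
        * indicator (cube (dyadic_centre k m) (3 * 2 powr real_of_int k)) x
        \<partial>count_space UNIV \<partial>count_space UNIV)"
    (is "_ \<le> (\<integral>\<^sup>+ k. \<integral>\<^sup>+ m. (?D * ?N k m) epowr q * ?ind k m \<partial>_ \<partial>_)" is "_ \<le> ?S")
proof -
  note [measurable_cong] = sets
  have "maximal_op \<mu> n \<alpha> B f x \<le> ?S epowr (1 / q)"
    unfolding maximal_op_def
  proof (rule SUP_least, clarify)
    fix c :: "real ^ 'd" and l :: real
    assume l: "0 < l" and x: "x \<in> cube c l"
    obtain k m where k: "l \<le> 2 powr real_of_int k"
      and sub: "cube c l \<subseteq> cube (dyadic_centre k m) (3 * 2 powr real_of_int k)"
      and le: "lux_avg \<mu> n B c l (\<lambda>y. ennreal \<bar>f y\<bar>) \<le> ?D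
       * lux_avg \<mu> n B (dyadic_centre k m) (2 powr real_of_int k) (\<lambda>y. ennreal \<bar>f y\<bar>)"
      by (rule lux_avg_le_dyadic[OF B sets _ l n, of "\<lambda>y. ennreal \<bar>f y\<bar>" c]) auto
    have "ennreal (l powr \<alpha>) * lux_avg \<mu> n B c l (\<lambda>y. ennreal \<bar>f y\<bar>)
        \<le> ennreal ((2 powr real_of_int k) powr \<alpha>)
          * (?D * lux_avg \<mu> n B (dyadic_centre k m) (2 powr real_of_int k) (\<lambda>y. ennreal \<bar>f y\<bar>))"
      using k l \<alpha> by (intro mult_mono le ennreal_leI powr_mono2) auto
    also have "\<dots> = ?D * ?N k m" by (simp only: mult_ac)
    also have "\<dots> = ((?D * ?N k m) epowr q * ?ind k m) epowr (1 / q)"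
      using x sub q by (auto simp: epowr_epowr)
    also have "\<dots> \<le> ?S epowr (1 / q)"
    proof (rule epowr_mono)
      have "(?D * ?N k m) epowr q * ?ind k m
          \<le> (\<integral>\<^sup>+ m. (?D * ?N k m) epowr q * ?ind k m \<partial>count_space UNIV)"
        by (rule nn_integral_ge_point) simp
      also have "\<dots> \<le> ?S" by (rule nn_integral_ge_point) simp
      finally show "(?D * ?N k m) epowr q * ?ind k m \<le> ?S" .
    qed (use q in simp)
    finally show "ennreal (l powr \<alpha>) * lux_avg \<mu> n B c l (\<lambda>y. ennreal \<bar>f y\<bar>) \<le> ?S epowr (1 / q)" .
  qed
  then have "maximal_op \<mu> n \<alpha> B f x epowr q \<le> (?S epowr (1 / q)) epowr q"
    using q by (intro epowr_mono) auto
  then show ?thesis using q by (simp add: epowr_epowr)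
qed

lemma weighted_measure_cube_finite:
  assumes "weight \<mu> u"
  shows "weighted_measure \<mu> u (cube c l) < top"
proof -
  have "compact (cube c l)" by (simp add: cube_def)
  then have "set_integrable \<mu> (cube c l) u" and u: "\<And>x. 0 \<le> u x"
    using assms by (auto simp: weight_def)
  then have "(\<integral>\<^sup>+ x. ennreal (norm (indicator (cube c l) x *\<^sub>R u x)) \<partial>\<mu>) < \<infinity>"
    by (auto simp: set_integrable_def integrable_iff_bounded)
  also have "(\<integral>\<^sup>+ x. ennreal (norm (indicator (cube c l) x *\<^sub>R u x)) \<partial>\<mu>)
      = weighted_measure \<mu> u (cube c l)"
    unfolding weighted_measure_def
    using u by (intro nn_integral_cong) (auto simp: indicator_def)
  finally show ?thesis by simp
qed

theorem theorem1p2: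
  fixes \<mu> :: "(real ^ 'd) measure"
    and n \<alpha> p q p0 q0 C1 C2 :: real
    and A B C phi varphi :: "real \<Rightarrow> real"
    and u v :: "real ^ 'd \<Rightarrow> real"
  assumes "0 < n" and "n \<le> real CARD('d)"
    and "1 < p" and "p < q"
    and "0 \<le> \<alpha>" and "\<alpha> < n"
    and "upper_ahlfors n \<mu>"
    and "young B" and "submultiplicative B"
    and "1 < p0" and "\<alpha> > 0 \<longrightarrow> p0 \<le> n / \<alpha>" and "1 / q0 = 1 / p0 - \<alpha> / n"
    and "B_cond q0 (\<lambda>t. B t powr (q0 / p0))"
    and "young phi" and "young varphi"
    and "C1 > 0" and "C2 > 0"
    and "\<forall>t>0. C1 * young_inv varphi t * t powr (\<alpha> / n) \<le> young_inv B t"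
    and "\<forall>t>0. young_inv B t \<le> C2 * young_inv phi t * t powr (\<alpha> / n)"
    and "young A" and "young C"
    and "(\<lambda>t. young_inv A t * young_inv C t) \<preceq> young_inv B"
    and "B_cond p C"
    and "weight \<mu> u" and "weight \<mu> v"
    and "\<exists>K\<ge>0. \<forall>c l. l > 0 \<longrightarrow>
           ennreal (l powr (\<alpha> - n / p)) * weighted_measure \<mu> u (cube c (3 * l)) epowr (1 / q)
             * lux_avg \<mu> n A c l (weight_dual v p) \<le> ennreal K"
  shows "\<exists>K'\<ge>0. \<forall>f \<in> Lp_space \<mu> v p.
           Lp_norm \<mu> u q (maximal_op \<mu> n \<alpha> B f)
             \<le> ennreal K' * Lp_norm \<mu> v p (\<lambda>x. ennreal \<bar>f x\<bar>)"
proof -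
  note n = assms(1) and p = assms(3) and q = assms(4) and \<alpha> = assms(5) and ahlfors = assms(7)
    and B = assms(8) and A = assms(20) and C = assms(21) and dom = assms(22) and Bp = assms(23)
    and u = assms(24) and v = assms(25)
  have sets [measurable_cong]: "sets \<mu> = sets borel"
    using ahlfors by (simp add: upper_ahlfors_def)
  have [measurable]: "u \<in> borel_measurable \<mu>" "v \<in> borel_measurable \<mu>"
    and v0: "\<And>x. 0 \<le> v x"
    using u v by (auto simp: weight_def)
  obtain K where K: "0 \<le> K" and bump: "\<And>c l. 0 < l \<Longrightarrow>
           ennreal (l powr (\<alpha> - n / p)) * weighted_measure \<mu> u (cube c (3 * l)) epowr (1 / q)
             * lux_avg \<mu> n A c l (weight_dual v p) \<le> ennreal K"
    using assms(26) by blast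
  obtain D where D: "0 < D" and holder:
    "\<And>(\<mu> :: (real ^ 'd) measure) n c l h g w t. upper_ahlfors n \<mu> \<Longrightarrow> 0 < l \<Longrightarrow>
      h \<in> borel_measurable \<mu> \<Longrightarrow> g \<in> borel_measurable \<mu> \<Longrightarrow> w \<in> borel_measurable \<mu> \<Longrightarrow>
      (\<And>x. w x < top \<Longrightarrow> h x \<le> g x * w x) \<Longrightarrow> lux_avg \<mu> n A c l w < ennreal t \<Longrightarrow>
      lux_avg \<mu> n B c l h \<le> ennreal (D * t) * lux_avg \<mu> n C c l g"
    using lux_avg_holder[OF A B C dom] by blast
  obtain c where c: "0 < c" and carleson:
    "\<And>(\<mu> :: (real ^ 'd) measure) g. upper_ahlfors n \<mu> \<Longrightarrow> g \<in> borel_measurable \<mu> \<Longrightarrow> (\<And>x. 0 \<le> g x) \<Longrightarrow>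
      (\<integral>\<^sup>+ k. \<integral>\<^sup>+ m. ennreal (2 powr (n * (q / p) * real_of_int k))
         * lux_avg \<mu> n C (dyadic_centre k m) (2 powr real_of_int k) (\<lambda>x. ennreal (g x)) epowr q
         \<partial>count_space UNIV \<partial>count_space UNIV)
      \<le> ennreal c * (\<integral>\<^sup>+ x. ennreal (g x powr p) \<partial>\<mu>) epowr (q / p)"
    using dyadic_carleson[OF C Bp n p q] by blast
  define D1 where "D1 = 2 ^ CARD('d) * 2 powr n"
  define E where "E = D1 * (D * (K + 1))"
  have E: "0 \<le> E" using D K by (simp add: E_def D1_def)
  have "Lp_norm \<mu> u q (maximal_op \<mu> n \<alpha> B f)
      \<le> ennreal (E * c powr (1 / q)) * Lp_norm \<mu> v p (\<lambda>x. ennreal \<bar>f x\<bar>)" if f: "f \<in> Lp_space \<mu> v p" for f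
  proof -
    have [measurable]: "f \<in> borel_measurable \<mu>" using f by (simp add: Lp_space_def)
    define g where "g x = \<bar>f x\<bar> * v x powr (1 / p)" for x
    have [measurable]: "g \<in> borel_measurable \<mu>" unfolding g_def by measurable
    have [measurable]: "weight_dual v p \<in> borel_measurable \<mu>" unfolding weight_dual_def by measurable
    define V where "V k m = weighted_measure \<mu> u (cube (dyadic_centre k m) (3 * 2 powr real_of_int k))"
      for k and m :: "'d \<Rightarrow> int"
    define N where "N k m = ennreal ((2 powr real_of_int k) powr \<alpha>)
        * lux_avg \<mu> n B (dyadic_centre k m) (2 powr real_of_int k) (\<lambda>y. ennreal \<bar>f y\<bar>)" for k m
    define L where "L k m = lux_avg \<mu> n C (dyadic_centre k m) (2 powr real_of_int k) (\<lambda>x. ennreal (g x))" for k m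

    \<comment> \<open>If the weight \<open>u\<close> vanishes on the tripled cube, the left side is \<open>0\<close>, whatever the averages are.
      Otherwise the bump condition makes the average of \<open>v powr (-1/p)\<close> finite.\<close>
    have one_cube: "N k m * V k m epowr (1 / q)
        \<le> ennreal (D * (K + 1)) * (ennreal ((2 powr real_of_int k) powr (n / p)) * L k m)" for k m
    proof (cases "V k m = 0")
      case False
      define s where "s = (2::real) powr real_of_int k"
      have s: "0 < s" by (simp add: s_def)
      define a where "a = lux_avg \<mu> n A (dyadic_centre k m) s (weight_dual v p)"
      have "V k m < top" unfolding V_def using u by (rule weighted_measure_cube_finite)
      then obtain U where U: "V k m epowr (1 / q) = ennreal U" "0 < U"
        using False by (cases "V k m") (auto simp: epowr_ennreal)
      have le: "ennreal (s powr (\<alpha> - n / p) * U) * a \<le> ennreal K"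
        using bump[OF s, of "dyadic_centre k m"] U s
        by (simp add: V_def s_def a_def ennreal_mult)
      define b where "b = s powr (\<alpha> - n / p) * U"
      have b: "0 < b" using s U by (simp add: b_def)
      have "a \<noteq> top" using le b by (auto simp: b_def[symmetric] ennreal_mult_top top_unique)
      then obtain a' where a': "a = ennreal a'" "0 \<le> a'" by (cases a) auto
      have "b * a' \<le> K" using le a' b K by (simp add: b_def[symmetric] flip: ennreal_mult)
      \<comment> \<open>A number strictly above the average of the dual weight that still satisfies the bump
        condition, with \<open>K + 1\<close> in place of \<open>K\<close>.\<close>
      define t where "t = (K + 1) / b"
      have "a' < t" using \<open>b * a' \<le> K\<close> b by (simp add: t_def field_simps)
      then have "a < ennreal t" and t: "0 < t" using a' by (auto simp: ennreal_less_iff)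
      then have "lux_avg \<mu> n B (dyadic_centre k m) s (\<lambda>y. ennreal \<bar>f y\<bar>) \<le> ennreal (D * t) * L k m"
        unfolding L_def s_def[symmetric]
      proof (intro holder[OF ahlfors s, where w = "weight_dual v p"])
        fix x assume w: "weight_dual v p x < top"
        \<comment> \<open>Where \<open>v\<close> is positive, \<open>\<bar>f\<bar>\<close> is exactly \<open>g\<close> times the dual weight.\<close>
        then have "v x \<noteq> 0" by (auto simp: weight_dual_def)
        then have "0 < v x" using v0[of x] by simp
        then show "ennreal \<bar>f x\<bar> \<le> ennreal (g x) * weight_dual v p x"
          by (simp add: g_def weight_dual_def inverse_ennreal mult.assoc flip: ennreal_mult)
      qed (auto simp: a_def)
      then have "N k m * V k m epowr (1 / q)
          \<le> ennreal (s powr \<alpha>) * (ennreal (D * t) * L k m) * ennreal U"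
        unfolding N_def s_def[symmetric] U by (intro mult_right_mono mult_left_mono) auto
      also have "\<dots> = ennreal (s powr \<alpha> * (D * t) * U) * L k m"
        using U D t by (simp add: ennreal_mult mult_ac)
      also have "s powr \<alpha> * (D * t) * U = D * (K + 1) * s powr (n / p)"
        using U s by (simp add: t_def b_def powr_diff field_simps)
      finally show ?thesis using D K by (simp add: s_def ennreal_mult mult.assoc)
    qed simp
    have one_cube_q: "(ennreal D1 * N k m) epowr q * V k m
        \<le> ennreal (E powr q) * (ennreal (2 powr (n * (q / p) * real_of_int k)) * L k m epowr q)" for k m
    proof -
      have "(ennreal D1 * N k m) epowr q * V k m = (ennreal D1 * (N k m * V k m epowr (1 / q))) epowr q"
        using p q by (simp add: epowr_mult epowr_epowr mult_ac)
      also have "\<dots> \<le> (ennreal D1 * (ennreal (D * (K + 1))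
          * (ennreal ((2 powr real_of_int k) powr (n / p)) * L k m))) epowr q"
        using p q by (intro epowr_mono mult_left_mono one_cube) auto
      also have "ennreal D1 * (ennreal (D * (K + 1)) * (ennreal ((2 powr real_of_int k) powr (n / p)) * L k m))
          = ennreal E * (ennreal ((2 powr real_of_int k) powr (n / p)) * L k m)"
        using D K by (simp add: E_def D1_def ennreal_mult mult.assoc)
      also have "\<dots> epowr q = ennreal (E powr q)
          * (ennreal (2 powr (n * (q / p) * real_of_int k)) * L k m epowr q)"
        using E by (simp add: epowr_mult epowr_ennreal powr_powr mult_ac)
      finally show ?thesis .
    qed

    have "(\<integral>\<^sup>+ x. (maximal_op \<mu> n \<alpha> B f x epowr q) * ennreal (u x) \<partial>\<mu>)
        \<le> (\<integral>\<^sup>+ x. (\<integral>\<^sup>+ k. \<integral>\<^sup>+ m. (ennreal D1 * N k m) epowr q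
            * indicator (cube (dyadic_centre k m) (3 * 2 powr real_of_int k)) x
            \<partial>count_space UNIV \<partial>count_space UNIV) * ennreal (u x) \<partial>\<mu>)"
      using p q maximal_op_le_dyadic_sum[OF B sets _ n \<alpha>]
      by (intro nn_integral_mono mult_right_mono) (auto simp: D1_def N_def)
    also have "\<dots> = (\<integral>\<^sup>+ x. (\<integral>\<^sup>+ k. \<integral>\<^sup>+ m. (ennreal D1 * N k m) epowr q
            * (ennreal (u x) * indicator (cube (dyadic_centre k m) (3 * 2 powr real_of_int k)) x)
            \<partial>count_space UNIV \<partial>count_space UNIV) \<partial>\<mu>)"
      unfolding nn_integral_multc[OF borel_measurable_count_space, symmetric] by (simp only: mult_ac)
    also have "\<dots> = (\<integral>\<^sup>+ k. \<integral>\<^sup>+ x. (\<integral>\<^sup>+ m. (ennreal D1 * N k m) epowr q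
            * (ennreal (u x) * indicator (cube (dyadic_centre k m) (3 * 2 powr real_of_int k)) x)
            \<partial>count_space UNIV) \<partial>\<mu> \<partial>count_space UNIV)"
      by (intro nn_integral_count_space_nn_integral borel_measurable_nn_integral_count_space) auto
    also have "\<dots> = (\<integral>\<^sup>+ k. \<integral>\<^sup>+ m. (ennreal D1 * N k m) epowr q * V k m
        \<partial>count_space UNIV \<partial>count_space UNIV)"
      by (subst nn_integral_count_space_nn_integral)
        (auto simp: nn_integral_cmult V_def weighted_measure_def)
    also have "\<dots> \<le> (\<integral>\<^sup>+ k. \<integral>\<^sup>+ m. ennreal (E powr q)
          * (ennreal (2 powr (n * (q / p) * real_of_int k)) * L k m epowr q)
        \<partial>count_space UNIV \<partial>count_space UNIV)"
      by (intro nn_integral_mono one_cube_q)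
    also have "\<dots> = ennreal (E powr q) * (\<integral>\<^sup>+ k. \<integral>\<^sup>+ m.
          ennreal (2 powr (n * (q / p) * real_of_int k)) * L k m epowr q
        \<partial>count_space UNIV \<partial>count_space UNIV)"
      by (simp only: nn_integral_cmult borel_measurable_count_space)
    also have "\<dots> \<le> ennreal (E powr q)
        * (ennreal c * (\<integral>\<^sup>+ x. ennreal (g x powr p) \<partial>\<mu>) epowr (q / p))"
      unfolding L_def by (intro mult_left_mono carleson[OF ahlfors]) (auto simp: g_def)
    also have "(\<integral>\<^sup>+ x. ennreal (g x powr p) \<partial>\<mu>) = (\<integral>\<^sup>+ x. (ennreal \<bar>f x\<bar> epowr p) * ennreal (v x) \<partial>\<mu>)"
      using p v0 by (intro nn_integral_cong)
        (simp add: g_def epowr_ennreal powr_mult powr_powr flip: ennreal_mult)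
    finally have "Lp_norm \<mu> u q (maximal_op \<mu> n \<alpha> B f)
        \<le> (ennreal (E powr q) * (ennreal c
            * (\<integral>\<^sup>+ x. (ennreal \<bar>f x\<bar> epowr p) * ennreal (v x) \<partial>\<mu>) epowr (q / p))) epowr (1 / q)"
      unfolding Lp_norm_def using p q by (intro epowr_mono) auto
    also have "\<dots> = ennreal (E * c powr (1 / q)) * Lp_norm \<mu> v p (\<lambda>x. ennreal \<bar>f x\<bar>)"
      using p q E c by (simp add: Lp_norm_def epowr_mult epowr_epowr epowr_ennreal powr_powr ennreal_mult mult.assoc)
    finally show ?thesis .
  qed
  then show ?thesis using E by (intro exI[of _ "E * c powr (1 / q)"]) auto
qed

end
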